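(* Let $\ell=tp^n+k$ with integers $t\ge 0$, $1\le k\le p^n$, and suppose $\max(r+s-p^{n+1},0)+1\le\ell\le\min(r,s)$ and $m>0$. Assume that $t\le\min(r_n,s_n)$ and $1\le k\le\max(e,0)$. Then $\lambda_\ell=(r_n+s_n-2t)p^n+p^n$, so $(g-1)^{(r_n+s_n-2t)p^n}$ maps $D_{(r_n+s_n-t)p^n+R+S-k}$ to $D_{tp^n+R+S-k}$, and the following hold. (1) Define $z_\ell\in D_{tp^n+R+S-k}$ by \[z_\ell=\sum_{i=0}^t(-1)^i(-1)^{R-k}v_{ip^n+R+1-k,\,(t-i)p^n+S}.\] Then $(g-1)^{p^n-1}(z_\ell)=x_{(t-1)p^n+R+S+1-k}$. (2) Let $P$ be the $(t+1)\times(t+1)$ matrix over $F$ with $(i,j)$ entry $\binom{r_n+s_n-2t}{r_n-t+j-i}$ (which is invertible), let $X$ be the $(t+1)\times1$ matrix with $(i,1)$ entry $(-1)^{i-1}$, and let $\zeta=P^{-1}X$. Define $y_\ell\in D_{(r_n+s_n-t)p^n+R+S-k}$ by \[y_\ell=\sum_{i=0}^t\zeta_{i+1,1}(-1)^{R-k}v_{(r_n-t+i)p^n+R+1-k,\,(s_n-i)p^n+S}.\] Then $(g-1)^{(r_n+s_n-2t)p^n}(y_\ell)=z_\ell$.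
   Context: $p$ is a prime, $F$ a field of characteristic $p$, $G=\langle g\rangle$ a cyclic group of order $q=p^a$ ($a$ a positive integer). $V_q$ is the indecomposable $FG$-module of dimension $q$, with ordered $F$-basis $(v_1,\dots,v_q)$ such that $gv_1=v_1$ and $gv_i=v_{i-1}+v_i$ for $i>1$; $V_i=\langle v_1,\dots,v_i\rangle$, and $V_1,\dots,V_q$ is a complete set of indecomposable $FG$-modules. Let $1\le r,s\le q$ and write $V_r\otimes V_s\cong V_{\lambda_1}\oplus\dots\oplus V_{\lambda_{\min(r,s)}}$ with $\lambda_1\ge\dots\ge\lambda_{\min(r,s)}>0$. Let $n$ be the unique nonnegative integer with $p^n\le\max(r,s)<p^{n+1}$, and write $r=r_np^n+R$, $s=s_np^n+S$ with integers $0\le r_n,s_n<p$ and $0\le R,S<p^n$ (the paper writes $R_{n-1},S_{n-1}$). Put $m=\min(R,S)$ and $e=R+S-p^n$. The elements $v_{i,j}=v_i\otimes g^{n-i}v_j$ ($1\le i\le r$, $1\le j\le s$) form a basis of $V_r\otimes V_s$ satisfying $(g-1)v_{i,j}=v_{i-1,j}+v_{i,j-1}$, with $v_{i,j}=0$ if $i\le0$ or $j\le0$. Put $D_d=\langle v_{i,j}\mid i+j=d+1\rangle$ for $1\le d\le r+s-1$ and $x_d=\sum_{i=1}^d(-1)^{i-1}v_{i,d+1-i}$ for $1\le d\le\min(r,s)$. Binomial coefficients $\binom cd$ are $0$ if $d<0$ or $d>c$, and are regarded as elements of $F$. *)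

theory Defs
  imports
    "HOL-Algebra.Multiplicative_Group"
    "HOL-Library.Function_Algebras"
    "Jordan_Normal_Form.Gauss_Jordan_Elimination"
begin

text \<open>Vector spaces over the field \<open>'f\<close> are spaces of coordinate functions
  \<open>'i \<Rightarrow> 'f\<close>, with the pointwise additive structure of
  \<open>HOL-Library.Function_Algebras\<close>.\<close>

definition fscale :: "'f::field \<Rightarrow> ('i \<Rightarrow> 'f) \<Rightarrow> 'i \<Rightarrow> 'f" where
  "fscale c f = (\<lambda>i. c * f i)"

lemma vector_space_fscale: "vector_space (fscale :: 'f::field \<Rightarrow> ('i \<Rightarrow> 'f) \<Rightarrow> 'i \<Rightarrow> 'f)"
  by unfold_locales (auto simp: fscale_def algebra_simps)

abbreviation fspan :: "('i \<Rightarrow> 'f::field) set \<Rightarrow> ('i \<Rightarrow> 'f) set" where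
  "fspan \<equiv> Modules.module.span fscale"

text \<open>An \<open>FG\<close>-module: a subspace \<open>U\<close> of an \<open>F\<close>-vector space (with scalar multiplication
  \<open>sc\<close>) with a linear action \<open>\<rho>\<close> of the group \<open>G\<close>. Only the restriction of \<open>\<rho> x\<close> to \<open>U\<close>
  matters.\<close>

definition FG_module ::
  "('g, 'h) monoid_scheme \<Rightarrow> ('f::field \<Rightarrow> 'v::ab_group_add \<Rightarrow> 'v) \<Rightarrow> 'v set
    \<Rightarrow> ('g \<Rightarrow> 'v \<Rightarrow> 'v) \<Rightarrow> bool" where
  "FG_module G sc U \<rho> \<longleftrightarrow>
     vector_space sc \<and> Modules.module.subspace sc U \<and>
     (\<forall>x\<in>carrier G. \<forall>u\<in>U. \<rho> x u \<in> U) \<and>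
     (\<forall>x\<in>carrier G. \<forall>u\<in>U. \<forall>w\<in>U. \<rho> x (u + w) = \<rho> x u + \<rho> x w) \<and>
     (\<forall>x\<in>carrier G. \<forall>c. \<forall>u\<in>U. \<rho> x (sc c u) = sc c (\<rho> x u)) \<and>
     (\<forall>u\<in>U. \<rho> \<one>\<^bsub>G\<^esub> u = u) \<and>
     (\<forall>x\<in>carrier G. \<forall>y\<in>carrier G. \<forall>u\<in>U. \<rho> (x \<otimes>\<^bsub>G\<^esub> y) u = \<rho> x (\<rho> y u))"

definition FG_isomorphic ::
  "('g, 'h) monoid_scheme
    \<Rightarrow> ('f::field \<Rightarrow> 'v::ab_group_add \<Rightarrow> 'v) \<Rightarrow> 'v set \<Rightarrow> ('g \<Rightarrow> 'v \<Rightarrow> 'v)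
    \<Rightarrow> ('f \<Rightarrow> 'w::ab_group_add \<Rightarrow> 'w) \<Rightarrow> 'w set \<Rightarrow> ('g \<Rightarrow> 'w \<Rightarrow> 'w) \<Rightarrow> bool" where
  "FG_isomorphic G sc U \<rho> sc' W \<sigma> \<longleftrightarrow>
     (\<exists>\<phi>. bij_betw \<phi> U W \<and>
        (\<forall>u\<in>U. \<forall>w\<in>U. \<phi> (u + w) = \<phi> u + \<phi> w) \<and>
        (\<forall>c. \<forall>u\<in>U. \<phi> (sc c u) = sc' c (\<phi> u)) \<and>
        (\<forall>x\<in>carrier G. \<forall>u\<in>U. \<phi> (\<rho> x u) = \<sigma> x (\<phi> u)))"

text \<open>The external direct sum of the modules \<open>U i\<close>, \<open>i \<in> I\<close> (for finite \<open>I\<close>), all of them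
  submodules of one ambient module with action \<open>\<rho>\<close>.\<close>

definition dsum_carrier :: "'i set \<Rightarrow> ('i \<Rightarrow> 'v::zero set) \<Rightarrow> ('i \<Rightarrow> 'v) set" where
  "dsum_carrier I U = {h. (\<forall>i\<in>I. h i \<in> U i) \<and> (\<forall>i. i \<notin> I \<longrightarrow> h i = 0)}"

definition dsum_scale :: "('f \<Rightarrow> 'v \<Rightarrow> 'v) \<Rightarrow> 'f \<Rightarrow> ('i \<Rightarrow> 'v) \<Rightarrow> 'i \<Rightarrow> 'v" where
  "dsum_scale sc c h = (\<lambda>i. sc c (h i))"

definition dsum_act :: "('g \<Rightarrow> 'v \<Rightarrow> 'v) \<Rightarrow> 'g \<Rightarrow> ('i \<Rightarrow> 'v) \<Rightarrow> 'i \<Rightarrow> 'v" where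
  "dsum_act \<rho> x h = (\<lambda>i. \<rho> x (h i))"

definition bvec :: "nat \<Rightarrow> nat \<Rightarrow> 'f::field" where
  "bvec i = (\<lambda>j. if j = i then 1 else 0)"

definition V :: "nat \<Rightarrow> (nat \<Rightarrow> 'f::field) set" where
  "V d = fspan (bvec ` {1..d})"

text \<open>\<open>G = \<langle>g\<rangle>\<close> acts on \<open>V q\<close> by one full Jordan block in the ordered basis
  \<open>bvec 1, \<dots>, bvec q\<close>.\<close>

definition jordan_block_module ::
  "('g, 'h) monoid_scheme \<Rightarrow> 'g \<Rightarrow> nat \<Rightarrow> ('g \<Rightarrow> (nat \<Rightarrow> 'f::field) \<Rightarrow> nat \<Rightarrow> 'f) \<Rightarrow> bool" where
  "jordan_block_module G g q \<rho> \<longleftrightarrow>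
     FG_module G fscale (V q) \<rho> \<and>
     \<rho> g (bvec 1) = bvec 1 \<and>
     (\<forall>i. 1 < i \<and> i \<le> q \<longrightarrow> \<rho> g (bvec i) = bvec (i - 1) + bvec i)"

text \<open>The tensor product of two spaces of coordinate functions is realised inside the
  functions on pairs; the pure tensors of standard basis vectors are again the standard
  basis vectors.\<close>

definition tens :: "(nat \<Rightarrow> 'f::field) \<Rightarrow> (nat \<Rightarrow> 'f) \<Rightarrow> nat \<times> nat \<Rightarrow> 'f" where
  "tens u w = (\<lambda>(i, j). u i * w j)"

definition tensor_space ::
  "(nat \<Rightarrow> 'f::field) set \<Rightarrow> (nat \<Rightarrow> 'f) set \<Rightarrow> (nat \<times> nat \<Rightarrow> 'f) set" where
  "tensor_space U W = fspan {tens u w | u w. u \<in> U \<and> w \<in> W}"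

text \<open>The diagonal action on \<open>V r \<otimes> V s\<close>, by linear extension from the basis; lemma
  \<open>tensor_act_tens\<close> confirms \<open>x (u \<otimes> w) = x u \<otimes> x w\<close>.\<close>

definition tensor_act ::
  "nat \<Rightarrow> nat \<Rightarrow> ('g \<Rightarrow> (nat \<Rightarrow> 'f::field) \<Rightarrow> nat \<Rightarrow> 'f) \<Rightarrow> 'g
    \<Rightarrow> (nat \<times> nat \<Rightarrow> 'f) \<Rightarrow> nat \<times> nat \<Rightarrow> 'f" where
  "tensor_act r s \<rho> x f =
     (\<Sum>i = 1..r. \<Sum>j = 1..s. fscale (f (i, j)) (tens (\<rho> x (bvec i)) (\<rho> x (bvec j))))"

text \<open>\<open>V r \<otimes> V s \<cong> V (\<lambda> 1) \<oplus> \<dots> \<oplus> V (\<lambda> (min r s))\<close> with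
  \<open>\<lambda> 1 \<ge> \<dots> \<ge> \<lambda> (min r s) > 0\<close>; only \<open>V 1, \<dots>, V q\<close> are \<open>FG\<close>-modules.\<close>

definition tensor_decomposition ::
  "('g, 'h) monoid_scheme \<Rightarrow> nat \<Rightarrow> ('g \<Rightarrow> (nat \<Rightarrow> 'f::field) \<Rightarrow> nat \<Rightarrow> 'f)
    \<Rightarrow> nat \<Rightarrow> nat \<Rightarrow> (nat \<Rightarrow> nat) \<Rightarrow> bool" where
  "tensor_decomposition G q \<rho> r s lam \<longleftrightarrow>
     (\<forall>i\<in>{1..min r s}. 0 < lam i \<and> lam i \<le> q) \<and>
     (\<forall>i j. 1 \<le> i \<and> i \<le> j \<and> j \<le> min r s \<longrightarrow> lam j \<le> lam i) \<and>
     FG_isomorphic G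
       fscale (tensor_space (V r) (V s)) (tensor_act r s \<rho>)
       (dsum_scale fscale) (dsum_carrier {1..min r s} (\<lambda>i. V (lam i))) (dsum_act \<rho>)"

definition gm1 ::
  "'g \<Rightarrow> nat \<Rightarrow> nat \<Rightarrow> ('g \<Rightarrow> (nat \<Rightarrow> 'f::field) \<Rightarrow> nat \<Rightarrow> 'f)
    \<Rightarrow> (nat \<times> nat \<Rightarrow> 'f) \<Rightarrow> nat \<times> nat \<Rightarrow> 'f" where
  "gm1 g r s \<rho> f = tensor_act r s \<rho> g f - f"

text \<open>Indices and the exponent of \<open>g\<close> are integers, so no subtraction is truncated.\<close>

definition vv ::
  "('g, 'h) monoid_scheme \<Rightarrow> 'g \<Rightarrow> ('g \<Rightarrow> (nat \<Rightarrow> 'f::field) \<Rightarrow> nat \<Rightarrow> 'f) \<Rightarrow> nat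
    \<Rightarrow> int \<Rightarrow> int \<Rightarrow> nat \<times> nat \<Rightarrow> 'f" where
  "vv G g \<rho> n i j =
     (if i \<le> 0 \<or> j \<le> 0 then 0
      else tens (bvec (nat i)) (\<rho> (g [^]\<^bsub>G\<^esub> (int n - i)) (bvec (nat j))))"

definition DD ::
  "('g, 'h) monoid_scheme \<Rightarrow> 'g \<Rightarrow> ('g \<Rightarrow> (nat \<Rightarrow> 'f::field) \<Rightarrow> nat \<Rightarrow> 'f) \<Rightarrow> nat
    \<Rightarrow> nat \<Rightarrow> nat \<Rightarrow> int \<Rightarrow> (nat \<times> nat \<Rightarrow> 'f) set" where
  "DD G g \<rho> n r s d =
     fspan {vv G g \<rho> n i j | i j. 1 \<le> i \<and> i \<le> int r \<and> 1 \<le> j \<and> j \<le> int s \<and> i + j = d + 1}"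

definition xx ::
  "('g, 'h) monoid_scheme \<Rightarrow> 'g \<Rightarrow> ('g \<Rightarrow> (nat \<Rightarrow> 'f::field) \<Rightarrow> nat \<Rightarrow> 'f) \<Rightarrow> nat
    \<Rightarrow> int \<Rightarrow> nat \<times> nat \<Rightarrow> 'f" where
  "xx G g \<rho> n d = (\<Sum>i = 1..d. fscale ((- 1) ^ nat (i - 1)) (vv G g \<rho> n i (d + 1 - i)))"

definition binom :: "nat \<Rightarrow> int \<Rightarrow> 'f::field" where
  "binom c d = (if d < 0 then 0 else of_nat (c choose nat d))"

text \<open>Rows and columns of matrices are numbered from 0. The entry of \<open>Pmat\<close> only depends
  on \<open>j - i\<close>; the exponent in \<open>Xmat\<close> is that of \<open>(-1)\<^sup>i\<^sup>-\<^sup>1\<close> after the shift.\<close>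

definition Pmat :: "nat \<Rightarrow> nat \<Rightarrow> nat \<Rightarrow> 'f::field mat" where
  "Pmat rn sn t =
     mat (t + 1) (t + 1) (\<lambda>(i, j). binom (rn + sn - 2 * t) (int rn - int t + int j - int i))"

definition Xmat :: "nat \<Rightarrow> 'f::field mat" where
  "Xmat t = mat (t + 1) 1 (\<lambda>(i, _). (- 1) ^ i)"

interpretation fvs: vector_space "fscale :: 'f::field \<Rightarrow> ('i \<Rightarrow> 'f) \<Rightarrow> 'i \<Rightarrow> 'f"
  by (rule vector_space_fscale)

lemma V_expand:
  fixes u :: "nat \<Rightarrow> 'f::field"
  assumes "\<And>i. i \<notin> {1..d} \<Longrightarrow> u i = 0"
  shows "u = (\<Sum>i = 1..d. fscale (u i) (bvec i))"
proof
  fix j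
  have "(\<Sum>i = 1..d. fscale (u i) (bvec i)) j = (\<Sum>i = 1..d. if j = i then u i else 0)"
    by (induction d) (auto simp: fscale_def bvec_def)
  also have "\<dots> = u j"
    using assms[of j] by auto
  finally show "u j = (\<Sum>i = 1..d. fscale (u i) (bvec i)) j" ..
qed

lemma V_iff: "(u :: nat \<Rightarrow> 'f::field) \<in> V d \<longleftrightarrow> (\<forall>i. i \<notin> {1..d} \<longrightarrow> u i = 0)"
proof
  assume "u \<in> V d"
  then show "\<forall>i. i \<notin> {1..d} \<longrightarrow> u i = 0"
    unfolding V_def
    by (induction rule: fvs.span_induct_alt) (auto simp: fscale_def bvec_def)
next
  assume "\<forall>i. i \<notin> {1..d} \<longrightarrow> u i = 0"
  then have "u = (\<Sum>i = 1..d. fscale (u i) (bvec i))"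
    by (intro V_expand) auto
  also have "\<dots> \<in> V d"
    unfolding V_def by (intro fvs.span_sum fvs.span_scale fvs.span_base) auto
  finally show "u \<in> V d" .
qed

lemma bvec_in_V: "1 \<le> i \<Longrightarrow> i \<le> d \<Longrightarrow> (bvec i :: nat \<Rightarrow> 'f::field) \<in> V d"
  by (auto simp: V_iff bvec_def)

lemma FG_module_sum:
  assumes "FG_module G fscale (V q) \<rho>" "x \<in> carrier G" "d \<le> q"
  shows "\<rho> x (\<Sum>i = 1..d. fscale (c i) (bvec i)) = (\<Sum>i = 1..d. fscale (c i) (\<rho> x (bvec i)))"
  using assms(3)
proof (induction d)
  case 0
  have "0 \<in> V q" by (simp add: V_iff)
  then have "\<rho> x (fscale 0 0) = fscale 0 (\<rho> x 0)"
    using assms unfolding FG_module_def by blast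
  then show ?case by (simp add: zero_fun_def)
next
  case (Suc d)
  have mem: "(\<Sum>i = 1..d. fscale (c i) (bvec i)) \<in> V q"
    unfolding V_def using Suc.prems by (intro fvs.span_sum fvs.span_scale fvs.span_base) auto
  have b: "bvec (Suc d) \<in> V q" using Suc.prems by (intro bvec_in_V) auto
  then have b': "fscale (c (Suc d)) (bvec (Suc d)) \<in> V q"
    unfolding V_def by (intro fvs.span_scale)
  have "\<rho> x (fscale (c (Suc d)) (bvec (Suc d))) = fscale (c (Suc d)) (\<rho> x (bvec (Suc d)))"
    using assms(1,2) b unfolding FG_module_def by blast
  moreover have "\<rho> x ((\<Sum>i = 1..d. fscale (c i) (bvec i)) + fscale (c (Suc d)) (bvec (Suc d)))
      = \<rho> x (\<Sum>i = 1..d. fscale (c i) (bvec i)) + \<rho> x (fscale (c (Suc d)) (bvec (Suc d)))"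
    using assms(1,2) mem b' unfolding FG_module_def by blast
  ultimately show ?case using Suc by (simp add: plus_fun_def)
qed

lemma tens_sum:
  fixes a b :: "nat \<Rightarrow> nat \<Rightarrow> 'f::field"
  shows "tens (\<Sum>i = 1..r. fscale (u i) (a i)) (\<Sum>j = 1..s. fscale (w j) (b j))
   = (\<Sum>i = 1..r. \<Sum>j = 1..s. fscale (u i * w j) (tens (a i) (b j)))"
proof -
  have ev: "(\<Sum>i\<in>A. h i) m = (\<Sum>i\<in>A. h i m)" for A :: "nat set" and h :: "nat \<Rightarrow> 'm \<Rightarrow> 'f" and m
    by (induction A rule: infinite_finite_induct) auto
  show ?thesis
    by (rule ext)
       (auto simp: tens_def ev fscale_def sum_product mult_ac split: prod.split intro!: sum.cong)
qed

lemma tensor_act_tens: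
  assumes M: "FG_module G fscale (V q) \<rho>" "x \<in> carrier G" and "r \<le> q" "s \<le> q"
    and u: "u \<in> V r" and w: "w \<in> V s"
  shows "tensor_act r s \<rho> x (tens u w) = tens (\<rho> x u) (\<rho> x w)"
proof -
  have "u = (\<Sum>i = 1..r. fscale (u i) (bvec i))" "w = (\<Sum>i = 1..s. fscale (w i) (bvec i))"
    using u w by (intro V_expand; simp add: V_iff)+
  then have "\<rho> x u = (\<Sum>i = 1..r. fscale (u i) (\<rho> x (bvec i)))"
    "\<rho> x w = (\<Sum>i = 1..s. fscale (w i) (\<rho> x (bvec i)))"
    using FG_module_sum[OF M] assms(3,4) by metis+
  moreover have "tens u w (i, j) = u i * w j" for i j
    by (simp add: tens_def)
  ultimately show ?thesis
    by (simp only: tensor_act_def tens_sum)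
qed

lemma V_invariant:
  fixes \<rho> :: "'g \<Rightarrow> (nat \<Rightarrow> 'f::field) \<Rightarrow> nat \<Rightarrow> 'f"
  assumes G: "group G" "g \<in> carrier G" "carrier G = generate G {g}" "finite (carrier G)"
    and M: "jordan_block_module G g q \<rho>" and d: "d \<le> q"
    and x: "x \<in> carrier G" and u: "u \<in> V d"
  shows "\<rho> x u \<in> V d"
proof -
  interpret group G by fact
  have FG: "FG_module G fscale (V q) \<rho>" using M by (simp add: jordan_block_module_def)
  have exp: "u = (\<Sum>i = 1..d. fscale (u i) (bvec i))" if "u \<in> V d" for u :: "nat \<Rightarrow> 'f"
    using that by (intro V_expand) (simp add: V_iff)
  have bv: "\<rho> g (bvec i) \<in> V d" if "i \<in> {1..d}" for i
  proof (cases "i = 1")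
    case True
    then show ?thesis using M that by (simp add: jordan_block_module_def bvec_in_V)
  next
    case False
    then have "\<rho> g (bvec i) = bvec (i - 1) + bvec i"
      using M that d by (simp add: jordan_block_module_def)
    moreover have "(bvec (i - 1) :: nat \<Rightarrow> 'f) \<in> V d" "(bvec i :: nat \<Rightarrow> 'f) \<in> V d"
      using that False by (auto intro!: bvec_in_V)
    ultimately show ?thesis by (simp add: V_def fvs.span_add)
  qed
  have gV: "\<rho> g u \<in> V d" if u: "u \<in> V d" for u :: "nat \<Rightarrow> 'f"
  proof -
    have "\<rho> g u = (\<Sum>i = 1..d. fscale (u i) (\<rho> g (bvec i)))"
      using FG_module_sum[OF FG G(2) d, of u] exp[OF u] by simp
    also have "\<dots> \<in> V d"
      using bv unfolding V_def by (intro fvs.span_sum fvs.span_scale) auto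
    finally show ?thesis .
  qed
  have sub: "u \<in> V q" if "u \<in> V d" for u :: "nat \<Rightarrow> 'f"
    using that d by (auto simp: V_iff)
  have powV: "\<rho> (g [^]\<^bsub>G\<^esub> k) u \<in> V d" if "u \<in> V d" for u :: "nat \<Rightarrow> 'f" and k :: nat
    using that
  proof (induction k arbitrary: u)
    case 0
    then show ?case using FG sub[OF 0] by (simp add: FG_module_def)
  next
    case (Suc k)
    have "\<rho> (g [^]\<^bsub>G\<^esub> Suc k) u = \<rho> (g [^]\<^bsub>G\<^esub> k) (\<rho> g u)"
      using FG sub[OF Suc.prems] G(2) by (simp add: FG_module_def)
    then show ?case using Suc.IH gV Suc.prems by simp
  qed
  obtain k :: nat where "x = g [^]\<^bsub>G\<^esub> k"
    using generate_pow_on_finite_carrier[OF G(4,2)] x G(3) by auto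
  then show ?thesis using powV u by simp
qed

lemma gm1_vv:
  fixes \<rho> :: "'g \<Rightarrow> (nat \<Rightarrow> 'f::field) \<Rightarrow> nat \<Rightarrow> 'f"
  assumes G: "group G" "g \<in> carrier G" "carrier G = generate G {g}" "finite (carrier G)"
    and M: "jordan_block_module G g q \<rho>" and "r \<le> q" "s \<le> q"
    and i: "1 \<le> i" "i \<le> int r" and j: "1 \<le> j" "j \<le> int s"
  shows "gm1 g r s \<rho> (vv G g \<rho> n i j) = vv G g \<rho> n (i - 1) j + vv G g \<rho> n i (j - 1)"
proof -
  interpret group G by fact
  have FG: "FG_module G fscale (V q) \<rho>" using M by (simp add: jordan_block_module_def)
  define h where "h = g [^]\<^bsub>G\<^esub> (int n - i)"
  have h: "h \<in> carrier G" using G(2) by (simp add: h_def)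
  have gh: "g \<otimes>\<^bsub>G\<^esub> h = g [^]\<^bsub>G\<^esub> (int n - (i - 1))"
    "h \<otimes>\<^bsub>G\<^esub> g = g [^]\<^bsub>G\<^esub> (int n - (i - 1))"
    using G(2) int_pow_mult[of g 1 "int n - i"] int_pow_mult[of g "int n - i" 1]
    by (simp_all add: h_def algebra_simps)
  define a b where "a = nat i" and "b = nat j"
  have ab: "1 \<le> a" "a \<le> r" "1 \<le> b" "b \<le> s" using i j by (auto simp: a_def b_def)
  have Va: "bvec a \<in> V r" and Vb: "bvec b \<in> V s" using ab by (auto intro: bvec_in_V)
  have Vq: "u \<in> V q" if "u \<in> V s" for u :: "nat \<Rightarrow> 'f"
    using that \<open>s \<le> q\<close> by (auto simp: V_iff)
  define A where "A = (if i = 1 then 0 else bvec (a - 1) :: nat \<Rightarrow> 'f)"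
  define B where "B = (if j = 1 then 0 else bvec (b - 1) :: nat \<Rightarrow> 'f)"
  have ga: "\<rho> g (bvec a) = bvec a + A"
    using M ab i \<open>r \<le> q\<close> by (auto simp: jordan_block_module_def A_def a_def)
  have gb: "\<rho> g (bvec b) = bvec b + B"
    using M ab j \<open>s \<le> q\<close> by (auto simp: jordan_block_module_def B_def b_def)
  have VB: "B \<in> V s" using ab j by (auto simp: B_def b_def V_iff bvec_def)
  have lin: "\<rho> h (bvec b + B) = \<rho> h (bvec b) + \<rho> h B"
    using FG h Vq[OF Vb] Vq[OF VB] by (auto simp: FG_module_def)
  have h0: "\<rho> h 0 = 0"
    using FG_module_sum[OF FG h, of 0] by (simp add: zero_fun_def)
  have c1: "\<rho> g (\<rho> h (bvec b)) = \<rho> h (bvec b) + \<rho> h B"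
    and c2: "\<rho> g (\<rho> h (bvec b)) = \<rho> (g [^]\<^bsub>G\<^esub> (int n - (i - 1))) (bvec b)"
  proof -
    have "\<rho> g (\<rho> h (bvec b)) = \<rho> (g \<otimes>\<^bsub>G\<^esub> h) (bvec b)"
      using FG G(2) h Vq[OF Vb] by (auto simp: FG_module_def)
    also have "\<dots> = \<rho> (h \<otimes>\<^bsub>G\<^esub> g) (bvec b)" by (simp only: gh)
    also have "\<dots> = \<rho> h (\<rho> g (bvec b))"
      using FG G(2) h Vq[OF Vb] by (auto simp: FG_module_def)
    finally show "\<rho> g (\<rho> h (bvec b)) = \<rho> h (bvec b) + \<rho> h B" by (simp only: gb lin)
    show "\<rho> g (\<rho> h (bvec b)) = \<rho> (g [^]\<^bsub>G\<^esub> (int n - (i - 1))) (bvec b)"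
      unfolding gh(1)[symmetric] using FG G(2) h Vq[OF Vb] by (auto simp: FG_module_def)
  qed
  have v1: "vv G g \<rho> n i j = tens (bvec a) (\<rho> h (bvec b))"
    using i j by (simp add: vv_def a_def b_def h_def)
  have v2: "vv G g \<rho> n (i - 1) j = tens A (\<rho> g (\<rho> h (bvec b)))"
    using i j by (auto simp: vv_def c2[unfolded b_def] A_def a_def b_def nat_diff_distrib tens_def fun_eq_iff)
  have v3: "vv G g \<rho> n i (j - 1) = tens (bvec a) (\<rho> h B)"
    using i j h0 by (auto simp: vv_def B_def a_def b_def h_def nat_diff_distrib tens_def fun_eq_iff)
  have "tensor_act r s \<rho> g (vv G g \<rho> n i j) = tens (\<rho> g (bvec a)) (\<rho> g (\<rho> h (bvec b)))"
    unfolding v1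
    by (rule tensor_act_tens[OF FG G(2) \<open>r \<le> q\<close> \<open>s \<le> q\<close> Va
          V_invariant[OF G M \<open>s \<le> q\<close> h Vb]])
  also have "\<dots> = tens (bvec a) (\<rho> h (bvec b) + \<rho> h B) + tens A (\<rho> g (\<rho> h (bvec b)))"
    unfolding ga c1 by (auto simp: tens_def fun_eq_iff algebra_simps)
  finally show ?thesis
    unfolding gm1_def v1 v2 v3 by (auto simp: tens_def fun_eq_iff algebra_simps)
qed

end

theory Submission
  imports Defs "Jordan_Normal_Form.Determinant"
begin

text \<open>Leaves the name \<open>order\<close> to the order of a group.\<close>

hide_const (open) Polynomial.order

text \<open>The vectors \<open>v i j\<close> behave like the monomials \<open>X\<^sup>r\<^sup>-\<^sup>i Y\<^sup>s\<^sup>-\<^sup>j\<close> of a truncated polynomial ring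
  on which \<open>g - 1\<close> acts as multiplication by \<open>X + Y\<close>. In characteristic \<open>p\<close> the power
  \<open>(X + Y) ^ (p ^ n)\<close> is \<open>X ^ (p ^ n) + Y ^ (p ^ n)\<close> and \<open>(X + Y) ^ (p ^ n - 1)\<close> has alternating
  coefficients; this gives (1) and (2), for every \<open>k \<ge> 1\<close> and not only for \<open>k \<le> e\<close>.

  A polynomial divisible by \<open>(1 + X) ^ c\<close> with at most \<open>c\<close> exponents, pairwise distinct
  modulo \<open>p\<close>, is zero. Applied to \<open>(1 + X) ^ (rn + sn - 2 * t)\<close> times the polynomial with
  coefficient vector \<open>\<zeta>\<close>, this shows that \<open>P\<close> is invertible and that the alternating sum of
  \<open>\<zeta>\<close> is nonzero.

  With \<open>L = (rn + sn - 2 * t) * p ^ n + p ^ n\<close>, the vectors \<open>y\<close> for all \<open>k \<ge> 1\<close> settle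
  \<open>\<lambda>\<^sub>l = L\<close>: their images show that the first \<open>t * p ^ n + e\<close> of the \<open>x d\<close> lie in the image of
  \<open>(g - 1) ^ (L - 1)\<close>, while they themselves are killed by \<open>(g - 1) ^ L\<close> and, for
  \<open>k \<le> min r s - t * p ^ n\<close>, are independent modulo the image of \<open>g - 1\<close>, because the alternating
  sum of \<open>\<zeta>\<close> is nonzero.\<close>

subsection \<open>The matrix \<open>P\<close>\<close>

text \<open>The operator \<open>X d/dX - \<mu>\<close> removes the exponent \<open>\<mu>\<close> and costs one factor \<open>1 + X\<close>.\<close>

lemma sparse_poly_zero:
  fixes f :: "'f::field poly"
  assumes "finite M" and "inj_on (of_nat :: nat \<Rightarrow> 'f) M"
    and "\<And>m. m \<notin> M \<Longrightarrow> coeff f m = 0"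
    and "[:1, 1:] ^ card M dvd f"
  shows "f = 0"
  using assms
proof (induction M arbitrary: f rule: finite_induct)
  case empty
  then show ?case by (simp add: poly_eq_iff)
next
  case (insert \<mu> M)
  define h where "h = pCons 0 (pderiv f) - smult (of_nat \<mu>) f"
  have ch: "coeff h m = (of_nat m - of_nat \<mu>) * coeff f m" for m
    by (cases m) (simp_all add: h_def coeff_pderiv coeff_pCons algebra_simps)
  obtain u where u: "f = [:1, 1:] ^ Suc (card M) * u"
    using insert.prems(3) insert.hyps by (metis card_insert_disjoint dvdE)
  have "pderiv f = [:1, 1:] ^ card M * (smult (of_nat (Suc (card M))) u + [:1, 1:] * pderiv u)"
    unfolding u pderiv_mult pderiv_power_Suc by (simp add: pderiv_pCons algebra_simps)
  then have "[:1, 1:] ^ card M dvd pderiv f" by simp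
  moreover have "pCons 0 (pderiv f) = [:0, 1:] * pderiv f" by simp
  ultimately have "[:1, 1:] ^ card M dvd pCons 0 (pderiv f)"
    by (metis dvd_mult)
  moreover have "[:1, 1:] ^ card M dvd f" unfolding u power_Suc2 mult.assoc by (rule dvd_triv_left)
  ultimately have dh: "[:1, 1:] ^ card M dvd h"
    unfolding h_def by (intro dvd_diff dvd_smult)
  have "h = 0"
  proof (rule insert.IH)
    show "inj_on (of_nat :: nat \<Rightarrow> 'f) M" using insert.prems(1) by simp
    show "coeff h m = 0" if "m \<notin> M" for m
      using insert.prems(2)[of m] that by (cases "m = \<mu>") (auto simp: ch)
  qed (rule dh)
  \<comment> \<open>Exponents in M differ from \<mu> in the field, so the factor in
    \<open>ch\<close> is nonzero there and \<open>h = 0\<close> kills every coefficient except the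
    one at \<mu>.\<close>
  have z: "coeff f m = 0" if "m \<noteq> \<mu>" for m
  proof (cases "m \<in> M")
    case True
    then have "(of_nat m :: 'f) \<noteq> of_nat \<mu>"
      using insert.prems(1) that by (auto simp: inj_on_def)
    then show ?thesis using ch[of m] \<open>h = 0\<close> by simp
  qed (use insert.prems(2) that in auto)
  have f: "f = monom (coeff f \<mu>) \<mu>"
    by (rule poly_eqI) (use z in auto)
  \<comment> \<open>At least one factor 1 + X remains in f, and a monomial vanishes at -1 only if
    its coefficient does.\<close>
  have "poly f (- 1) = 0" unfolding u by simp
  then have "coeff f \<mu> = 0"
    by (subst (asm) f) (simp add: poly_monom)
  then show ?case using f by simp
qed

lemma inj_on_of_nat_CHAR:
  assumes "CHAR('f::field) = p" and "\<And>m. m \<in> M \<Longrightarrow> m < p"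
  shows "inj_on (of_nat :: nat \<Rightarrow> 'f) M"
proof -
  have "x = y" if "x < p" "y < p" "(of_nat x :: 'f) = of_nat y" "x \<le> y" for x y
    using that assms(1) of_nat_eq_iff_char_dvd[where 'a='f, of x y] nat_dvd_not_less[of "y - x" p]
    by (cases "x = y") auto
  note le = this
  show ?thesis
  proof (rule inj_onI)
    fix x y assume *: "x \<in> M" "y \<in> M" "(of_nat x :: 'f) = of_nat y"
    then have "x < p" "y < p" using assms(2) by blast+
    then show "x = y" using le[of x y] le[of y x] *(3) by (cases "x \<le> y") simp_all
  qed
qed

lemma coeff_one_plus_X_power:
  "coeff ([:1, 1:] ^ c :: 'f::field poly) m = of_nat (c choose m)"
proof (cases "m \<le> c")
  case True
  then show ?thesis using coeff_linear_poly_power[of m c "1::'f" 1] by simp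
next
  case False
  then have "degree ([:1, 1:] ^ c :: 'f poly) < m" by (simp add: degree_linear_power)
  then show ?thesis using False by (simp add: coeff_eq_0 binomial_eq_0 del: degree_linear_power)
qed

text \<open>The bound \<open>small\<close> keeps every exponent up to rn + sn - t + 1 below p. This
  is the degree bound for 1 + X times \<open>pascal_poly u\<close>, so
  \<open>sparse_poly_zero\<close> applies to both polynomials.\<close>

context
  fixes rn sn t p :: nat
  assumes char: "CHAR('f::field) = p" and t: "t \<le> rn" "t \<le> sn"
    and small: "rn + sn + 2 \<le> p + t"
begin

abbreviation (input) pascal_poly :: "(nat \<Rightarrow> 'f) \<Rightarrow> 'f poly" where
  "pascal_poly u \<equiv> [:1, 1:] ^ (rn + sn - 2 * t) * (\<Sum>j\<le>t. monom (u j) j)"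

text \<open>Since rn + sn - 2t = (rn - t) + (sn - t), symmetry turns the lower index rn - t + j - i
  into sn - t + i - j. If that is negative, the original lower index exceeds the upper one and the
  binomial is 0. Hence applying row i of P to u reads off a coefficient of a product of
  polynomials.\<close>

lemma binom_eq_coeff:
  assumes "i \<le> t" "j \<le> t"
  shows "(binom (rn + sn - 2 * t) (int rn - int t + int j - int i) :: 'f)
    = (if j \<le> sn - t + i then coeff ([:1, 1:] ^ (rn + sn - 2 * t)) (sn - t + i - j) else 0)"
proof (cases "j \<le> sn - t + i")
  case True
  show ?thesis
  proof (cases "i \<le> rn - t + j")
    case T: True
    have "int rn - int t + int j - int i = int (rn - t + j - i)" using T t by simp
    then have "(binom (rn + sn - 2 * t) (int rn - int t + int j - int i) :: 'f)
        = of_nat (rn + sn - 2 * t choose (rn - t + j - i))"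
      by (simp only: binom_def nat_int) simp
    moreover have "rn + sn - 2 * t - (rn - t + j - i) = sn - t + i - j" "rn - t + j - i \<le> rn + sn - 2 * t"
      using True T t by linarith+
    then have "rn + sn - 2 * t choose (rn - t + j - i) = rn + sn - 2 * t choose (sn - t + i - j)"
      by (metis binomial_symmetric)
    ultimately show ?thesis using True by (simp add: coeff_one_plus_X_power)
  next
    case False
    then have "rn + sn - 2 * t < sn - t + i - j" using True t by linarith
    then show ?thesis using True False t by (simp add: binom_def coeff_one_plus_X_power binomial_eq_0)
  qed
next
  case False
  then have "rn + sn - 2 * t < nat (int rn - int t + int j - int i)" using t by linarith
  then show ?thesis using False by (simp add: binom_def binomial_eq_0)
qed

lemma Pmat_row:
  assumes "i \<le> t"
  shows "(\<Sum>j\<le>t. binom (rn + sn - 2 * t) (int rn - int t + int j - int i) * u j)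
    = coeff (pascal_poly u) (sn - t + i)"
proof -
  have "coeff (pascal_poly u) (sn - t + i) = (\<Sum>j\<le>t. coeff (monom (u j) j * [:1, 1:] ^ (rn + sn - 2 * t)) (sn - t + i))"
    by (simp add: sum_distrib_right coeff_sum mult.commute[of "[:1, 1:] ^ _"])
  also have "\<dots> = (\<Sum>j\<le>t. binom (rn + sn - 2 * t) (int rn - int t + int j - int i) * u j)"
    by (intro sum.cong refl) (use assms in \<open>auto simp: coeff_monom_mult binom_eq_coeff\<close>)
  finally show ?thesis ..
qed

lemma degree_pascal_poly: "degree (pascal_poly u) \<le> rn + sn - t"
proof -
  have "degree (\<Sum>j\<le>t. monom (u j) j) \<le> t"
    by (intro degree_sum_le) (auto intro: order.trans[OF degree_monom_le])
  moreover have "degree ([:1, 1:] ^ (rn + sn - 2 * t) :: 'f poly) = rn + sn - 2 * t"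
    by (rule degree_linear_power)
  ultimately show ?thesis using degree_mult_le[of "[:1, 1:] ^ (rn + sn - 2 * t)" "\<Sum>j\<le>t. monom (u j) j"] t
    by linarith
qed

text \<open>When the t + 1 middle coefficients vanish, only sn - t exponents below and rn - t above
  them remain. Their number equals the power of 1 + X dividing the polynomial.\<close>

lemma Pmat_inj:
  assumes "\<And>i. i \<le> t \<Longrightarrow> coeff (pascal_poly u) (sn - t + i) = 0" and "j \<le> t"
  shows "u j = 0"
proof -
  have "pascal_poly u = 0"
  proof (rule sparse_poly_zero)
    let ?M = "{..<sn - t} \<union> {sn + 1..rn + sn - t}"
    show "finite ?M" by simp
    show "inj_on (of_nat :: nat \<Rightarrow> 'f) ?M"
      using char by (rule inj_on_of_nat_CHAR) (use small t in auto)
    show "coeff (pascal_poly u) m = 0" if "m \<notin> ?M" for m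
    proof (cases "m \<le> sn")
      case True
      then show ?thesis using that assms(1)[of "m - (sn - t)"] t by simp
    next
      case False
      then show ?thesis using that degree_pascal_poly[of u] by (intro coeff_eq_0) auto
    qed
    have "card ?M = rn + sn - 2 * t"
      by (subst card_Un_disjoint) (use t in auto)
    then show "[:1, 1:] ^ card ?M dvd pascal_poly u" by simp
  qed
  then have "(\<Sum>j\<le>t. monom (u j) j) = 0" by simp
  then have "coeff (\<Sum>j\<le>t. monom (u j) j) j = 0" by simp
  then show ?thesis using \<open>j \<le> t\<close> by (simp add: coeff_sum)
qed

text \<open>The alternating sum is the value at -1 of the polynomial with coefficients u, so its
  vanishing gives an extra factor 1 + X. Multiplying by one more factor cancels the alternating
  coefficients in neighbouring pairs. This leaves (sn - t + 1) + (rn - t + 1) exponents against as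
  many factors 1 + X, so the polynomial is 0, although its coefficient at sn - t is 1.\<close>

lemma alternating_sum_nonzero:
  assumes "\<And>i. i \<le> t \<Longrightarrow> coeff (pascal_poly u) (sn - t + i) = (- 1) ^ i"
  shows "(\<Sum>j\<le>t. (- 1) ^ j * u j) \<noteq> 0"
proof
  assume "(\<Sum>j\<le>t. (- 1) ^ j * u j) = 0"
  then have "poly (\<Sum>j\<le>t. monom (u j) j) (- 1) = 0"
    by (simp add: poly_sum poly_monom mult.commute)
  then have "[:1, 1:] dvd (\<Sum>j\<le>t. monom (u j) j)"
    by (simp add: poly_eq_0_iff_dvd)
  then obtain w where w: "(\<Sum>j\<le>t. monom (u j) j) = [:1, 1:] * w" by (elim dvdE)
  have "[:1, 1:] * pascal_poly u = [:1, 1:] ^ (rn + sn - 2 * t + 2) * w"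
    unfolding w power_add power2_eq_square by (simp only: mult_ac)
  then have d: "[:1, 1:] ^ (rn + sn - 2 * t + 2) dvd [:1, 1:] * pascal_poly u"
    by (rule dvdI)
  have c: "coeff ([:1, 1:] * h) m = coeff h m + (if m = 0 then 0 else coeff h (m - 1))"
    for h :: "'f poly" and m by (cases m) (simp_all)
  have "[:1, 1:] * pascal_poly u = 0"
  proof (rule sparse_poly_zero)
    let ?M = "{..sn - t} \<union> {sn + 1..rn + sn - t + 1}"
    show "finite ?M" by simp
    show "inj_on (of_nat :: nat \<Rightarrow> 'f) ?M"
      using char by (rule inj_on_of_nat_CHAR) (use small t in auto)
    show "coeff ([:1, 1:] * pascal_poly u) m = 0" if "m \<notin> ?M" for m
    proof (cases "m \<le> sn")
      case True
      define i where "i = m - Suc (sn - t)"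
      have "m = sn - t + Suc i" "m - 1 = sn - t + i" "Suc i \<le> t"
        using that True t by (auto simp: i_def)
      then show ?thesis using assms[of "Suc i"] assms[of i] by (simp only: c) simp
    next
      case False
      then have "degree (pascal_poly u) < m - 1" using that degree_pascal_poly[of u] by auto
      then show ?thesis unfolding c by (simp add: coeff_eq_0)
    qed
    have "card ?M = rn + sn - 2 * t + 2"
      by (subst card_Un_disjoint) (use t in auto)
    then show "[:1, 1:] ^ card ?M dvd [:1, 1:] * pascal_poly u" using d by simp
  qed
  then have "[:1, 1:] = (0 :: 'f poly) \<or> pascal_poly u = 0" by (simp only: mult_eq_0_iff)
  then have "pascal_poly u = 0" by simp
  then show False using assms[of 0] by simp
qed

lemma Pmat_mult_index:
  fixes B :: "'f mat"
  assumes "B \<in> carrier_mat (t + 1) m" "i \<le> t" "k < m"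
  shows "(Pmat rn sn t * B) $$ (i, k) = coeff (pascal_poly (\<lambda>j. B $$ (j, k))) (sn - t + i)"
  unfolding Pmat_row[OF assms(2), symmetric]
  using assms by (auto simp: Pmat_def scalar_prod_def atLeast0LessThan lessThan_Suc_atMost
      intro!: sum.cong)

lemma Pmat_invertible: "invertible_mat (Pmat rn sn t :: 'f mat)"
  and Pmat_inverse_solves:
    "Pmat rn sn t * (the (mat_inverse (Pmat rn sn t)) * Xmat t) = (Xmat t :: 'f mat)"
  and Pmat_inverse_carrier: "the (mat_inverse (Pmat rn sn t)) * Xmat t \<in> (carrier_mat (t + 1) 1 :: 'f mat set)"
proof -
  let ?P = "Pmat rn sn t :: 'f mat"
  have P: "?P \<in> carrier_mat (t + 1) (t + 1)" by (simp add: Pmat_def)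
  have X: "(Xmat t :: 'f mat) \<in> carrier_mat (t + 1) 1" by (simp add: Xmat_def)
  have "det ?P \<noteq> 0"
  proof
    assume "det ?P = 0"
    then obtain w where w: "w \<in> carrier_vec (t + 1)" "w \<noteq> 0\<^sub>v (t + 1)" "?P *\<^sub>v w = 0\<^sub>v (t + 1)"
      using det_0_iff_vec_prod_zero[OF P] by blast
    have "coeff (pascal_poly (\<lambda>j. w $ j)) (sn - t + i) = 0" if "i \<le> t" for i
    proof -
      have "coeff (pascal_poly (\<lambda>j. w $ j)) (sn - t + i) = (?P *\<^sub>v w) $ i"
        unfolding Pmat_row[OF that, symmetric] using that w(1)
        by (auto simp: Pmat_def scalar_prod_def atLeast0LessThan lessThan_Suc_atMost intro!: sum.cong)
      then show ?thesis using w(3) that by simp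
    qed
    then have "w $ j = 0" if "j \<le> t" for j using Pmat_inj[of "\<lambda>j. w $ j"] that by blast
    then have "w = 0\<^sub>v (t + 1)" using w(1) by (intro eq_vecI) auto
    then show False using w(2) by simp
  qed
  \<comment> \<open>Being a unit excludes the value \<open>None\<close> of
    \<open>mat_inverse\<close>, so \<open>the\<close> returns a genuine inverse.\<close>
  then have "?P \<in> Units (ring_mat TYPE('f) (t + 1) ())" by (rule det_non_zero_imp_unit[OF P])
  then obtain B where "mat_inverse ?P = Some B" using mat_inverse(1)[OF P] by fastforce
  then have B: "?P * B = 1\<^sub>m (t + 1)" "B * ?P = 1\<^sub>m (t + 1)" "B \<in> carrier_mat (t + 1) (t + 1)"
    using mat_inverse(2)[OF P] by auto
  show "invertible_mat ?P"
    unfolding invertible_mat_def inverts_mat_def using B P by (auto intro!: exI[of _ B])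
  have the: "the (mat_inverse ?P) = B" using \<open>mat_inverse ?P = Some B\<close> by simp
  show "?P * (the (mat_inverse ?P) * Xmat t) = (Xmat t :: 'f mat)"
    using B P X unfolding the by (simp add: assoc_mult_mat[symmetric, OF P B(3) X])
  show "the (mat_inverse ?P) * Xmat t \<in> (carrier_mat (t + 1) 1 :: 'f mat set)"
    using B X unfolding the by simp
qed

end

subsection \<open>Families satisfying Pascal's rule\<close>

text \<open>In k * (p^n choose k) = p^n * (p^n - 1 choose k - 1), a binomial prime to p would force
  p^n to divide k.\<close>

lemma of_nat_prime_power_choose:
  assumes "prime p" "CHAR('f::field) = p" "0 < k" "k < p ^ n"
  shows "(of_nat (p ^ n choose k) :: 'f) = 0"
proof -
  have "p dvd (p ^ n choose k)"
  proof (rule ccontr)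
    assume "\<not> p dvd (p ^ n choose k)"
    then have "coprime (p ^ n) (p ^ n choose k)"
      using assms(1) by (simp add: prime_imp_coprime)
    moreover have "p ^ n dvd k * (p ^ n choose k)"
      using assms times_binomial_minus1_eq[of k "p ^ n"] by simp
    ultimately have "p ^ n dvd k" by (simp add: coprime_dvd_mult_left_iff)
    then show False using assms by (auto dest: dvd_imp_le)
  qed
  then show ?thesis using assms(2) by (simp add: of_nat_eq_0_iff_char_dvd)
qed

text \<open>By Pascal's rule and the preceding lemma, consecutive binomials add up to 0 in the
  field.\<close>

lemma of_nat_prime_power_minus_one_choose:
  assumes "prime p" "CHAR('f::field) = p" "k < p ^ n"
  shows "(of_nat (p ^ n - 1 choose k) :: 'f) = (- 1) ^ k"
  using assms(3)
proof (induction k)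
  case (Suc k)
  have "p ^ n choose Suc k = (p ^ n - 1 choose k) + (p ^ n - 1 choose Suc k)"
    using Suc.prems by (metis Suc_pred' binomial_Suc_Suc less_zeroE not_gr_zero)
  then have "(of_nat (p ^ n choose Suc k) :: 'f)
      = of_nat (p ^ n - 1 choose k) + of_nat (p ^ n - 1 choose Suc k)"
    by simp
  then show ?case
    using Suc of_nat_prime_power_choose[OF assms(1,2), of "Suc k" n]
    by (simp add: add_eq_0_iff)
qed simp

text \<open>In characteristic 2 the signs 1 and -1 coincide, so the sign computations below need no
  separate treatment of p = 2.\<close>

lemma neg_one_power_CHAR:
  assumes "prime p" "CHAR('f::field) = p"
  shows "(- 1 :: 'f) ^ (p ^ n) = - 1"
proof (cases "p = 2")
  case True
  then have "(2 :: 'f) = 0" using assms(2) by (metis of_nat_CHAR of_nat_numeral)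
  then have "(1 :: 'f) + 1 = 0" by (simp only: one_add_one)
  then have "(- 1 :: 'f) = 1" by (simp only: neg_eq_iff_add_eq_0)
  then show ?thesis by (simp only: power_one)
next
  case False
  then have "odd p" using assms(1) by (metis primes_dvd_imp_eq two_is_prime_nat)
  then show ?thesis by simp
qed

lemma sum_fun_apply: "(\<Sum>i\<in>A. h i) m = (\<Sum>i\<in>A. h i m)"
  for h :: "'i \<Rightarrow> 'm \<Rightarrow> 'f::field"
  by (induction A rule: infinite_finite_induct) auto

lemma linear_funpow:
  assumes "Vector_Spaces.linear fscale fscale (N :: ('i \<Rightarrow> 'f::field) \<Rightarrow> 'i \<Rightarrow> 'f)"
  shows "Vector_Spaces.linear fscale fscale (N ^^ m)"
proof (induction m)
  case 0
  show ?case unfolding funpow.simps id_def by (rule fvs.linear_ident)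
next
  case (Suc m)
  then show ?case unfolding funpow.simps
    by (rule Vector_Spaces.linear_compose) (rule assms)
qed

text \<open>The rule \<open>step\<close> has no lower bound on the indices: at nonpositive indices
  both sides are 0. Iteration only lowers indices, so it never leaves the range of the rule.\<close>

locale pascal_family =
  fixes N :: "('i \<Rightarrow> 'f::field) \<Rightarrow> 'i \<Rightarrow> 'f" and v :: "int \<Rightarrow> int \<Rightarrow> 'i \<Rightarrow> 'f" and r s :: nat
  assumes lin: "Vector_Spaces.linear fscale fscale N"
    and vanish: "i \<le> 0 \<or> j \<le> 0 \<Longrightarrow> v i j = 0"
    and step: "i \<le> int r \<Longrightarrow> j \<le> int s \<Longrightarrow> N (v i j) = v (i - 1) j + v i (j - 1)"
begin

lemmas pow_add = module_hom.add[OF Vector_Spaces.linear.axioms(3)[OF linear_funpow[OF lin]]]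
  and pow_scale = module_hom.scale[OF Vector_Spaces.linear.axioms(3)[OF linear_funpow[OF lin]]]
  and pow_zero = module_hom.zero[OF Vector_Spaces.linear.axioms(3)[OF linear_funpow[OF lin]]]
  and pow_sum = module_hom.sum[OF Vector_Spaces.linear.axioms(3)[OF linear_funpow[OF lin]]]

text \<open>The binomial theorem for two commuting shifts by c. It is used with e = c = 1, and again
  with e = c = p^n once the p^n-th power is known to be a sum of two shifts.\<close>

lemma pow_binomial:
  assumes "\<And>i j. i \<le> int r \<Longrightarrow> j \<le> int s \<Longrightarrow>
      (N ^^ e) (v i j) = v (i - int c) j + v i (j - int c)"
    and "i \<le> int r" "j \<le> int s"
  shows "(N ^^ (e * m)) (v i j) =
    (\<Sum>k\<le>m. fscale (of_nat (m choose k)) (v (i - int c * int k) (j - int c * (int m - int k))))"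
  using assms(2,3)
proof (induction m arbitrary: i j)
  case (Suc m)
  define F where "F k = v (i - int c * int k) (j - int c * (int (Suc m) - int k))" for k
  have "(N ^^ (e * Suc m)) (v i j) = (N ^^ (e * m)) ((N ^^ e) (v i j))"
    by (simp add: funpow_add add.commute[of e])
  also have "\<dots> = (N ^^ (e * m)) (v (i - int c) j) + (N ^^ (e * m)) (v i (j - int c))"
    using Suc.prems by (simp add: assms(1) pow_add)
  also have "(N ^^ (e * m)) (v (i - int c) j) = (\<Sum>k\<le>m. fscale (of_nat (m choose k)) (F (Suc k)))"
    using Suc.prems by (subst Suc.IH) (auto simp: F_def algebra_simps intro!: sum.cong)
  \<comment> \<open>The added term k = m + 1 has coefficient 0; it aligns the two sums for Pascal's
    rule.\<close>
  also have "(N ^^ (e * m)) (v i (j - int c)) = (\<Sum>k\<le>Suc m. fscale (of_nat (m choose k)) (F k))"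
    using Suc.prems by (subst Suc.IH) (auto simp: F_def algebra_simps fscale_def binomial_eq_0 zero_fun_def intro!: sum.cong)
  also have "\<dots> = F 0 + (\<Sum>k\<le>m. fscale (of_nat (m choose Suc k)) (F (Suc k)))"
    by (subst sum.atMost_Suc_shift) (simp add: fscale_def)
  also have "(\<Sum>k\<le>m. fscale (of_nat (m choose k)) (F (Suc k))) + \<dots>
      = F 0 + (\<Sum>k\<le>m. fscale (of_nat (Suc m choose Suc k)) (F (Suc k)))"
    by (simp add: sum.distrib[symmetric] fvs.scale_left_distrib[symmetric] add.left_commute)
  also have "\<dots> = (\<Sum>k\<le>Suc m. fscale (of_nat (Suc m choose k)) (F k))"
    by (subst sum.atMost_Suc_shift) (simp add: fscale_def)
  finally show ?case by (simp only: F_def)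
qed (simp add: fscale_def)

context
  fixes p n :: nat
  assumes prime: "prime p" and char: "CHAR('f) = p"
begin

lemma pow_prime_power:
  assumes "i \<le> int r" "j \<le> int s"
  shows "(N ^^ (p ^ n)) (v i j) = v (i - int (p ^ n)) j + v i (j - int (p ^ n))"
proof -
  have "0 < p ^ n" using prime prime_gt_0_nat by simp
  have "(N ^^ (1 * p ^ n)) (v i j) = (\<Sum>k\<le>p ^ n. fscale (of_nat (p ^ n choose k))
      (v (i - int 1 * int k) (j - int 1 * (int (p ^ n) - int k))))"
    by (rule pow_binomial) (use assms step in auto)
  also have "\<dots> = (\<Sum>k\<in>{0, p ^ n}. fscale (of_nat (p ^ n choose k))
      (v (i - int 1 * int k) (j - int 1 * (int (p ^ n) - int k))))"
    by (rule sum.mono_neutral_right)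
       (auto simp: of_nat_prime_power_choose[OF prime char] fscale_def)
  finally show ?thesis using \<open>0 < p ^ n\<close> by (simp add: fscale_def add.commute)
qed

lemma pow_prime_power_minus_one:
  assumes "i \<le> int r" "j \<le> int s"
  shows "(N ^^ (p ^ n - 1)) (v i j)
    = (\<Sum>k<p ^ n. fscale ((- 1) ^ k) (v (i - int k) (j - int (p ^ n) + 1 + int k)))"
proof -
  have "0 < p ^ n" using prime prime_gt_0_nat by simp
  have "(N ^^ (1 * (p ^ n - 1))) (v i j) = (\<Sum>k\<le>p ^ n - 1. fscale (of_nat (p ^ n - 1 choose k))
      (v (i - int 1 * int k) (j - int 1 * (int (p ^ n - 1) - int k))))"
    by (rule pow_binomial) (use assms step in auto)
  also have "{..p ^ n - 1} = {..<p ^ n}" using \<open>0 < p ^ n\<close> by (metis Suc_pred' lessThan_Suc_atMost)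
  finally show ?thesis
    using \<open>0 < p ^ n\<close>
    by (auto simp: of_nat_prime_power_minus_one_choose[OF prime char, unfolded One_nat_def]
        of_nat_diff algebra_simps intro!: sum.cong)
qed

lemma pow_mult_prime_power:
  assumes "i \<le> int r" "j \<le> int s"
  shows "(N ^^ (m * p ^ n)) (v i j) = (\<Sum>k\<le>m. fscale (of_nat (m choose k))
      (v (i - int (p ^ n) * int k) (j - int (p ^ n) * (int m - int k))))"
  unfolding mult.commute[of m]
  by (rule pow_binomial) (use pow_prime_power assms in auto)

end

text \<open>The vector x_d. With an integer d it is the empty sum for d <= 0, a case reached when
  \<open>zvec k\<close> is pushed down for large k.\<close>

definition xsum :: "int \<Rightarrow> 'i \<Rightarrow> 'f" where
  "xsum d = (\<Sum>i = 1..d. fscale ((- 1) ^ nat (i - 1)) (v i (d + 1 - i)))"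

lemma xsum_nonpos: "d \<le> 0 \<Longrightarrow> xsum d = 0"
  by (simp add: xsum_def)

lemma xsum_of_nat:
  "xsum (int d) = (\<Sum>i<d. fscale ((- 1) ^ i) (v (1 + int i) (int d - int i)))"
  unfolding xsum_def
  by (rule sum.reindex_bij_witness[of _ "\<lambda>i. int i + 1" "\<lambda>i. nat (i - 1)"]) (auto simp: algebra_simps)

text \<open>The alternating signs make the images telescope; the two end terms have an index
  0.\<close>

lemma N_xsum:
  assumes "d \<le> int r" "d \<le> int s"
  shows "N (xsum d) = 0"
proof (cases "d \<le> 0")
  case True
  then show ?thesis using pow_zero[of 1] by (simp add: xsum_nonpos)
next
  case False
  then obtain m where m: "d = int m" using nonneg_int_cases[of d] by force
  define A where "A i = fscale ((- 1) ^ i) (v (int i) (int m - int i))" for i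
  have "N (xsum (int m)) = (\<Sum>i<m. fscale ((- 1) ^ i) (N (v (1 + int i) (int m - int i))))"
    using pow_sum[of 1 "\<lambda>i. fscale ((- 1) ^ i) (v (1 + int i) (int m - int i))" "{..<m}"] pow_scale[of 1]
    by (simp add: xsum_of_nat)
  also have "\<dots> = (\<Sum>i<m. A i - A (Suc i))"
  proof (rule sum.cong[OF refl])
    fix i assume "i \<in> {..<m}"
    then have "N (v (1 + int i) (int m - int i)) = v (int i) (int m - int i) + v (1 + int i) (int m - int i - 1)"
      using step[of "1 + int i" "int m - int i"] assms m by simp
    then show "fscale ((- 1) ^ i) (N (v (1 + int i) (int m - int i))) = A i - A (Suc i)"
      by (simp add: A_def fvs.scale_right_distrib algebra_simps)
  qed
  also have "\<dots> = A 0 - A m" by (rule sum_lessThan_telescope')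
  also have "\<dots> = 0" by (simp add: A_def vanish)
  finally show ?thesis by (simp only: m)
qed

text \<open>Only the leading term v_{1,d'} of x_{d'} is seen by f. Such functionals prove that the
  x_d are independent.\<close>

lemma functional_xsum:
  assumes f: "Vector_Spaces.linear fscale (*) f"
    and fv: "\<And>i j. 1 \<le> i \<Longrightarrow> i \<le> int r \<Longrightarrow> 1 \<le> j \<Longrightarrow> j \<le> int s \<Longrightarrow>
      f (v i j) = (if i = 1 \<and> j = d then 1 else 0)"
    and d': "1 \<le> d'" "d' \<le> int r" "d' \<le> int s"
  shows "f (xsum d') = (if d' = d then 1 else 0)"
proof -
  interpret f: Vector_Spaces.linear fscale "(*)" f by (rule f)
  have "f (xsum d') = (\<Sum>i = 1..d'. (- 1) ^ nat (i - 1) * f (v i (d' + 1 - i)))"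
    by (simp add: xsum_def f.sum f.scale)
  also have "\<dots> = (\<Sum>i = 1..d'. if i = 1 then (if d' = d then 1 else 0) else 0)"
    using d' by (intro sum.cong refl) (auto simp: fv)
  also have "\<dots> = (if d' = d then 1 else 0)" using d' by simp
  finally show ?thesis .
qed

text \<open>The two terms of N (v i j) lie on one antidiagonal with neighbouring first indices, so
  the alternating weights cancel. The bounds on K exclude the borders, where one of the two terms is
  missing. Such functionals test independence modulo the image of N.\<close>

lemma functional_N:
  assumes f: "Vector_Spaces.linear fscale (*) f"
    and fv: "\<And>i j. 1 \<le> i \<Longrightarrow> i \<le> int r \<Longrightarrow> 1 \<le> j \<Longrightarrow> j \<le> int s \<Longrightarrow>
      f (v i j) = (if i + j = K then (- 1) ^ nat i else 0)"
    and K: "int r < K" "int s < K"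
    and ij: "1 \<le> i" "i \<le> int r" "1 \<le> j" "j \<le> int s"
  shows "f (N (v i j)) = 0"
proof -
  interpret f: Vector_Spaces.linear fscale "(*)" f by (rule f)
  have 1: "f (v (i - 1) j) = (if i - 1 + j = K then (- 1) ^ nat (i - 1) else 0)"
    using ij K fv[of "i - 1" j] by (cases "i = 1") (auto simp: vanish)
  have 2: "f (v i (j - 1)) = (if i + (j - 1) = K then (- 1) ^ nat i else 0)"
    using ij K fv[of i "j - 1"] by (cases "j = 1") (auto simp: vanish)
  have "nat i = Suc (nat (i - 1))" using ij by simp
  then show ?thesis using ij by (simp add: step f.add 1 2)
qed

end

section \<open>The vectors z and y\<close>

locale pascal_blocks = pascal_family N v r s
  for N :: "('i \<Rightarrow> 'f::field) \<Rightarrow> 'i \<Rightarrow> 'f" and v r s +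
  fixes p n rn sn R S t :: nat
  assumes prime: "prime p" and char: "CHAR('f) = p"
    and R: "R < p ^ n" and S: "S < p ^ n"
    and r: "r = rn * p ^ n + R" and s: "s = sn * p ^ n + S"
    and t: "t \<le> rn" "t \<le> sn"
begin

text \<open>Up to the sign \<open>(- 1) ^ (R - k)\<close> these are z and y. Dropping the sign
  allows k > R, where the natural exponent would be truncated; the bound on \<lambda> needs such
  k.\<close>

definition zvec :: "int \<Rightarrow> 'i \<Rightarrow> 'f" where
  "zvec k = (\<Sum>i\<le>t. fscale ((- 1) ^ i)
     (v (int i * int (p ^ n) + int R + 1 - k) ((int t - int i) * int (p ^ n) + int S)))"

definition yvec :: "(nat \<Rightarrow> 'f) \<Rightarrow> int \<Rightarrow> 'i \<Rightarrow> 'f" where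
  "yvec u k = (\<Sum>i\<le>t. fscale (u i) (v ((int rn - int t + int i) * int (p ^ n) + int R + 1 - k)
     ((int sn - int i) * int (p ^ n) + int S)))"

lemma index_le:
  assumes "1 \<le> k"
  shows "c \<le> int rn \<Longrightarrow> c * int (p ^ n) + int R + 1 - k \<le> int r"
    and "c \<le> int sn \<Longrightarrow> c * int (p ^ n) + int S \<le> int s"
  using assms mult_right_mono[of c "int rn" "int (p ^ n)"] mult_right_mono[of c "int sn" "int (p ^ n)"]
  by (simp_all add: r s)

text \<open>Each summand becomes an alternating run of p^n neighbours on one antidiagonal. The t + 1
  runs are adjacent with matching signs and join into one long run. Terms with a nonpositive index
  vanish, which leaves x_d up to sign.\<close>

lemma pow_zvec:
  assumes k: "1 \<le> k"
  shows "(N ^^ (p ^ n - 1)) (zvec (int k))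
    = fscale ((- 1) ^ (R + k)) (xsum ((int t - 1) * int (p ^ n) + int R + int S + 1 - int k))"
proof -
  define P where "P = p ^ n"
  have P: "0 < P" using prime by (simp add: P_def prime_gt_0_nat)
  have nP: "(- 1 :: 'f) ^ P = - 1" unfolding P_def by (rule neg_one_power_CHAR[OF prime char])
  have nP1: "(- 1 :: 'f) ^ (P - 1) = 1"
    using nP P by (cases P) auto
  define d where "d = (int t - 1) * int P + int R + int S + 1 - int k"
  \<comment> \<open>The smallest first index in the run of block 0, so block i occupies the first
    indices i * P + a up to i * P + P - 1 + a.\<close>
  define a where "a = int R + 2 - int k - int P"
  define F where "F j = fscale ((- 1) ^ j) (v (int j + a) (d + 1 - (int j + a)))" for j
  have blk: "(N ^^ (P - 1)) (v (int i * int P + int R + 1 - int k) ((int t - int i) * int P + int S))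
      = fscale ((- 1) ^ i) (sum F {i * P..<i * P + P})" if i: "i \<le> t" for i
  proof -
    have "(N ^^ (P - 1)) (v (int i * int P + int R + 1 - int k) ((int t - int i) * int P + int S))
      = (\<Sum>c<P. fscale ((- 1) ^ c) (v (int i * int P + int R + 1 - int k - int c)
          ((int t - int i) * int P + int S - int P + 1 + int c)))"
      unfolding P_def
      by (rule pow_prime_power_minus_one[OF prime char]; rule index_le) (use k t i in auto)
    also have "\<dots> = (\<Sum>c<P. fscale ((- 1) ^ i) (F (i * P + c)))"
    \<comment> \<open>The expansion lists first indices downwards; the reversal c to P - 1 - c keeps
      signs because (-1)^(P - 1) = 1.\<close>
    proof (rule sum.reindex_bij_witness[of _ "\<lambda>c. P - 1 - c" "\<lambda>c. P - 1 - c"])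
      fix c assume c: "c \<in> {..<P}"
      have "(- 1 :: 'f) ^ c * (- 1) ^ (P - 1 - c) = 1"
        using c nP1 by (simp flip: power_add)
      moreover have "(- 1 :: 'f) ^ (P - 1 - c) * (- 1) ^ (P - 1 - c) = 1"
        by (simp flip: power_mult_distrib)
      ultimately have "(- 1 :: 'f) ^ c * (- 1) ^ (P - 1 - c) = (- 1) ^ (P - 1 - c) * (- 1) ^ (P - 1 - c)"
        by (simp only:)
      then have sg: "(- 1 :: 'f) ^ c = (- 1) ^ (P - 1 - c)" by (subst (asm) mult_cancel_right) simp
      have "(- 1 :: 'f) ^ i * (- 1) ^ (i * P) = 1"
        by (simp add: power_mult mult.commute[of i] nP flip: power_mult_distrib)
      then have "(- 1 :: 'f) ^ i * (- 1) ^ (i * P + (P - 1 - c)) = (- 1) ^ c"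
        unfolding power_add sg by (simp flip: mult.assoc)
      moreover have "int (i * P + (P - 1 - c)) + a = int i * int P + int R + 1 - int k - int c"
        using c by (simp add: a_def of_nat_diff)
      moreover have "d + 1 - (int (i * P + (P - 1 - c)) + a)
          = (int t - int i) * int P + int S - int P + 1 + int c"
        using c by (simp add: a_def d_def of_nat_diff algebra_simps)
      ultimately show "fscale ((- 1) ^ i) (F (i * P + (P - 1 - c)))
          = fscale ((- 1) ^ c) (v (int i * int P + int R + 1 - int k - int c)
          ((int t - int i) * int P + int S - int P + 1 + int c))"
        by (simp only: F_def fvs.scale_scale)
    qed auto
    also have "\<dots> = fscale ((- 1) ^ i) (sum F {i * P..<i * P + P})"
      using sum.shift_bounds_nat_ivl[of F 0 "i * P" P]
      by (simp add: fvs.scale_sum_right[symmetric] atLeast0LessThan add.commute)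
    finally show ?thesis .
  qed
  have "(N ^^ (P - 1)) (zvec (int k)) = (\<Sum>i\<le>t. sum F {i * P..<i * P + P})"
    unfolding zvec_def P_def[symmetric] pow_sum pow_scale
    by (intro sum.cong refl) (simp only: atMost_iff blk fvs.scale_scale power_mult_distrib[symmetric], simp)
  also have "\<dots> = sum F {..<Suc t * P}"
    by (simp only: lessThan_Suc_atMost[symmetric] sum.nat_group)
  also have "\<dots> = (\<Sum>u = 1..d. fscale ((- 1) ^ (R + k) * (- 1) ^ nat (u - 1)) (v u (d + 1 - u)))"
  \<comment> \<open>The joined run covers all first indices 1..d by \<open>a1\<close> and
    \<open>dP\<close>; outside this range the first or the second index is nonpositive.\<close>
  proof (rule sum.reindex_bij_witness_not_neutral[of "{j. j < Suc t * P \<and> (int j + a < 1 \<or> d < int j + a)}" "{}"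
        _ "\<lambda>u. nat (u - a)" "\<lambda>j. int j + a"])
    have RS: "int R < int P" "int S < int P" using R S by (simp_all add: P_def)
    have a1: "a \<le> 1" using RS k by (simp add: a_def)
    have dP: "d - a < int (Suc t * P)"
      using RS by (simp add: a_def d_def algebra_simps)
    show "nat (int j + a - a) = j" for j by simp
    show "int j + a \<in> {1..d} - {}" if "j \<in> {..<Suc t * P} - {j. j < Suc t * P \<and> (int j + a < 1 \<or> d < int j + a)}" for j
      using that by auto
    show "int (nat (u - a)) + a = u" if "u \<in> {1..d} - {}" for u
      using that a1 by auto
    show "nat (u - a) \<in> {..<Suc t * P} - {j. j < Suc t * P \<and> (int j + a < 1 \<or> d < int j + a)}"
      if "u \<in> {1..d} - {}" for u
      using that a1 dP by (auto simp: nat_less_iff)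
    show "F j = 0" if "j \<in> {j. j < Suc t * P \<and> (int j + a < 1 \<or> d < int j + a)}" for j
    proof -
      have "v (int j + a) (d + 1 - (int j + a)) = 0" by (rule vanish) (use that in auto)
      then show ?thesis unfolding F_def by simp
    qed
    show "fscale ((- 1) ^ (R + k) * (- 1) ^ nat (int j + a - 1)) (v (int j + a) (d + 1 - (int j + a))) = F j"
      if "j \<in> {..<Suc t * P}" for j
    proof (cases "1 \<le> int j + a")
      case j: True
      have "P - 1 + (R + k + nat (int j + a - 1)) = 2 * R + j"
        using j P by (auto simp: a_def)
      then have "(- 1 :: 'f) ^ (P - 1) * ((- 1) ^ (R + k + nat (int j + a - 1))) = (- 1) ^ (2 * R + j)"
        by (simp only: power_add[symmetric])
      then have "(- 1 :: 'f) ^ (R + k) * (- 1) ^ nat (int j + a - 1) = (- 1) ^ j"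
        by (simp add: nP1[unfolded One_nat_def] power_add power_mult)
      then show ?thesis by (simp only: F_def)
    next
      case False
      then have "v (int j + a) (d + 1 - (int j + a)) = 0" by (intro vanish) auto
      then show ?thesis by (simp add: F_def)
    qed
  qed auto
  also have "\<dots> = fscale ((- 1) ^ (R + k)) (xsum d)"
    by (simp add: xsum_def fvs.scale_sum_right)
  finally show ?thesis by (simp only: P_def d_def)
qed

text \<open>The exponent is a multiple of p^n, so indices move by whole blocks. The j-th summand of
  y is sent to the combination of the summands of z given by column j of P, and the hypothesis on u
  says P u = X.\<close>

lemma pow_yvec:
  assumes k: "1 \<le> k"
    and u: "\<And>i. i \<le> t \<Longrightarrow>
      (\<Sum>j\<le>t. binom (rn + sn - 2 * t) (int rn - int t + int j - int i) * u j) = (- 1) ^ i"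
  shows "(N ^^ ((rn + sn - 2 * t) * p ^ n)) (yvec u k) = zvec k"
proof -
  define P where "P = p ^ n"
  define C where "C = rn + sn - 2 * t"
  define w where "w i = v (i * int P + int R + 1 - k) ((int t - i) * int P + int S)" for i
  have RS: "int R < int P" "int S < int P" using R S by (simp_all add: P_def)
  have w0: "w i = 0" if "i < 0 \<or> int t < i" for i
  proof -
    have "i * int P + int R + 1 - k \<le> 0" if "i < 0"
      using that k RS mult_right_mono[of i "- 1" "int P"] by simp
    moreover have "(int t - i) * int P + int S \<le> 0" if "int t < i"
      using that RS mult_right_mono[of "int t - i" "- 1" "int P"] by simp
    ultimately show ?thesis using that unfolding w_def by (intro vanish) auto
  qed
  have col: "(N ^^ (C * P)) (v ((int rn - int t + int j) * int P + int R + 1 - k)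
      ((int sn - int j) * int P + int S))
    = (\<Sum>i\<le>t. fscale (binom C (int rn - int t + int j - int i)) (w (int i)))" if j: "j \<le> t" for j
  proof -
    have "(N ^^ (C * P)) (v ((int rn - int t + int j) * int P + int R + 1 - k)
        ((int sn - int j) * int P + int S))
      = (\<Sum>c\<le>C. fscale (of_nat (C choose c))
          (v ((int rn - int t + int j) * int P + int R + 1 - k - int P * int c)
            ((int sn - int j) * int P + int S - int P * (int C - int c))))"
      unfolding P_def
      by (rule pow_mult_prime_power[OF prime char]; rule index_le) (use k t j in auto)
    also have "\<dots> = (\<Sum>c\<le>C. fscale (of_nat (C choose c)) (w (int rn - int t + int j - int c)))"
      using t by (intro sum.cong refl) (simp add: w_def C_def of_nat_diff algebra_simps)
    \<comment> \<open>Only block indices rn - t + j - c between 0 and t survive, by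
      \<open>w0\<close>.\<close>
    also have "\<dots> = (\<Sum>c | c \<le> C \<and> c \<le> rn - t + j \<and> rn - t + j \<le> c + t.
        fscale (of_nat (C choose c)) (w (int rn - int t + int j - int c)))"
      using t by (intro sum.mono_neutral_right) (auto intro!: w0)
    also have "\<dots> = (\<Sum>i | i \<le> t \<and> i \<le> rn - t + j \<and> rn - t + j \<le> i + C.
        fscale (binom C (int rn - int t + int j - int i)) (w (int i)))"
    proof (rule sum.reindex_bij_witness[of _ "\<lambda>i. rn - t + j - i" "\<lambda>c. rn - t + j - c"])
      fix c assume c: "c \<in> {c. c \<le> C \<and> c \<le> rn - t + j \<and> rn - t + j \<le> c + t}"
      have "int (rn - t + j - c) = int rn - int t + int j - int c" using c t by auto
      moreover from this have "int rn - int t + int j - int (rn - t + j - c) = int c" by linarith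
      ultimately show "fscale (binom C (int rn - int t + int j - int (rn - t + j - c))) (w (int (rn - t + j - c)))
          = fscale (of_nat (C choose c)) (w (int rn - int t + int j - int c))"
        by (simp only: binom_def) simp
    qed auto
    \<comment> \<open>The block indices added back here carry binomials whose lower index lies
      outside 0..C.\<close>
    also have "\<dots> = (\<Sum>i\<le>t. fscale (binom C (int rn - int t + int j - int i)) (w (int i)))"
    proof (intro sum.mono_neutral_left ballI)
      fix i assume "i \<in> {..t} - {i. i \<le> t \<and> i \<le> rn - t + j \<and> rn - t + j \<le> i + C}"
      then have "int rn - int t + int j - int i < 0 \<or> C < nat (int rn - int t + int j - int i)"
        using t by auto
      then have "binom C (int rn - int t + int j - int i) = (0 :: 'f)"
        by (auto simp: binom_def binomial_eq_0)
      then show "fscale (binom C (int rn - int t + int j - int i)) (w (int i)) = 0" by simp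
    qed auto
    finally show ?thesis .
  qed
  have "(N ^^ (C * P)) (yvec u k)
      = (\<Sum>j\<le>t. \<Sum>i\<le>t. fscale (binom C (int rn - int t + int j - int i) * u j) (w (int i)))"
    unfolding yvec_def P_def[symmetric] pow_sum pow_scale
    by (intro sum.cong refl) (simp only: atMost_iff col fvs.scale_sum_right fvs.scale_scale mult.commute[of "u _"])
  also have "\<dots> = (\<Sum>i\<le>t. fscale (\<Sum>j\<le>t. binom C (int rn - int t + int j - int i) * u j) (w (int i)))"
    by (subst sum.swap) (simp add: fvs.scale_sum_left)
  also have "\<dots> = zvec k"
    unfolding zvec_def w_def P_def C_def by (intro sum.cong refl) (simp add: u)
  finally show ?thesis by (simp only: C_def P_def)
qed

text \<open>All summands of \<open>yvec u k'\<close> lie on one antidiagonal, which f sees only if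
  k' = k. From one summand to the next the first index grows by p^n and the sign flips, so the
  alternating sum of u appears. Positivity of S keeps the second indices positive; the bound on k
  does so for the first indices when k' = k.\<close>

lemma functional_yvec:
  assumes f: "Vector_Spaces.linear fscale (*) f"
    and fv: "\<And>i j. 1 \<le> i \<Longrightarrow> i \<le> int r \<Longrightarrow> 1 \<le> j \<Longrightarrow> j \<le> int s \<Longrightarrow>
      f (v i j) = (if i + j = int r + int s + 1 - int t * int (p ^ n) - k then (- 1) ^ nat i else 0)"
    and S0: "0 < S" and k: "1 \<le> k" "int t * int (p ^ n) + k \<le> int r" and k': "1 \<le> k'"
  shows "f (yvec u k') = (if k' = k
    then (- 1) ^ nat (int r + 1 - int t * int (p ^ n) - k) * (\<Sum>i\<le>t. (- 1) ^ i * u i) else 0)"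
proof -
  interpret f: Vector_Spaces.linear fscale "(*)" f by (rule f)
  define P where "P = p ^ n"
  define A where "A = int r + 1 - int t * int P - k"
  have val: "f (v ((int rn - int t + int i) * int P + int R + 1 - k') ((int sn - int i) * int P + int S))
      = (if k' = k then (- 1) ^ nat A * (- 1) ^ i else 0)" (is "f (v ?a ?b) = _") if i: "i \<le> t" for i
  proof (cases "1 \<le> ?a")
    case True
    have "?a \<le> int r" "?b \<le> int s" unfolding P_def using index_le[of k'] k' i t by auto
    moreover have "0 \<le> (int sn - int i) * int P" using i t by simp
    then have "1 \<le> ?b" using S0 by linarith
    ultimately have "f (v ?a ?b) = (if ?a + ?b = int r + int s + 1 - int t * int P - k then (- 1) ^ nat ?a else 0)"
      using True unfolding P_def by (intro fv)
    moreover have "?a + ?b = int r + int s + 1 - int t * int P - k'"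
      by (simp add: r s P_def algebra_simps)
    moreover have "(- 1 :: 'f) ^ nat ?a = (- 1) ^ nat A * (- 1) ^ i" if "k' = k"
    proof -
      have "?a = A + int (i * P)" using that by (simp add: A_def r P_def algebra_simps)
      moreover have "0 \<le> A" using k by (simp add: A_def P_def)
      ultimately have "nat ?a = nat A + P * i" by (simp add: nat_add_distrib nat_mult_distrib)
      then show ?thesis
        using neg_one_power_CHAR[OF prime char, of n] by (simp add: power_add power_mult P_def)
    qed
    ultimately show ?thesis by auto
  next
    case False
    have "k' \<noteq> k"
    proof
      assume "k' = k"
      then have "?a = int r + 1 - int t * int P - k + int i * int P"
        by (simp add: r P_def algebra_simps)
      moreover have "0 \<le> int i * int P" by simp
      ultimately show False using k False unfolding P_def by linarith
    qed
    moreover have "v ?a ?b = 0" using False by (intro vanish) auto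
    ultimately show ?thesis by (simp add: f.zero)
  qed
  have eq: "f (yvec u k') = (\<Sum>i\<le>t. u i * (if k' = k then (- 1) ^ nat A * (- 1) ^ i else 0))"
    unfolding yvec_def P_def[symmetric] f.sum f.scale by (intro sum.cong refl) (simp only: atMost_iff val)
  show ?thesis
  proof (cases "k' = k")
    case True
    then show ?thesis
      unfolding eq P_def[symmetric] A_def[symmetric] if_P[OF True] sum_distrib_left
      by (intro sum.cong refl) (simp only: mult_ac)
  qed (simp add: eq)
qed

end

subsection \<open>Jordan block sizes of the tensor product\<close>

text \<open>Gaussian elimination, one equation at a time. Applied to coordinates, it takes the place
  of dimension counting.\<close>

lemma finite_homogeneous_system:
  fixes T :: "'d \<Rightarrow> 'i \<Rightarrow> 'f::field"
  assumes "finite I" and "finite J" and "card I < card J"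
  shows "\<exists>c. (\<exists>d\<in>J. c d \<noteq> 0) \<and> (\<forall>i\<in>I. (\<Sum>d\<in>J. c d * T d i) = 0)"
  using assms
proof (induction I arbitrary: J T rule: finite_induct)
  case empty
  then have "J \<noteq> {}" by auto
  then show ?case by (intro exI[of _ "\<lambda>_. 1"]) auto
next
  case (insert i I)
  show ?case
  proof (cases "\<forall>d\<in>J. T d i = 0")
    case True
    obtain c where "\<exists>d\<in>J. c d \<noteq> 0" "\<forall>i\<in>I. (\<Sum>d\<in>J. c d * T d i) = 0"
      using insert.IH[of J T] insert.prems insert.hyps by auto
    then show ?thesis using True by (intro exI[of _ c]) auto
  next
    case False
    then obtain e where e: "e \<in> J" "T e i \<noteq> 0" by blast
    define U where "U d k = T d k - T d i / T e i * T e k" for d k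
    have "card I < card (J - {e})" using insert.prems insert.hyps e by simp
    then obtain c where c: "\<exists>d\<in>J - {e}. c d \<noteq> 0"
      "\<forall>k\<in>I. (\<Sum>d\<in>J - {e}. c d * U d k) = 0"
      using insert.IH[of "J - {e}" U] insert.prems by auto
    \<comment> \<open>The value at the pivot e is the one that solves equation i; the modified rows
      U carry this substitution into the other equations.\<close>
    define b where "b = c(e := - (\<Sum>d\<in>J - {e}. c d * T d i) / T e i)"
    have "(\<Sum>d\<in>J. b d * T d k) = (\<Sum>d\<in>J - {e}. c d * U d k)" for k
    proof -
      have "(\<Sum>d\<in>J. b d * T d k) = b e * T e k + (\<Sum>d\<in>J - {e}. b d * T d k)"
        using insert.prems e by (simp add: sum.remove)
      also have "(\<Sum>d\<in>J - {e}. b d * T d k) = (\<Sum>d\<in>J - {e}. c d * T d k)"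
        by (intro sum.cong) (auto simp: b_def)
      also have "b e * T e k = - (\<Sum>d\<in>J - {e}. c d * (T d i / T e i * T e k))"
        by (simp add: b_def sum_distrib_right sum_divide_distrib mult.assoc)
      finally show ?thesis by (simp add: U_def right_diff_distrib sum_subtractf)
    qed
    moreover have "U d i = 0" for d using e by (simp add: U_def)
    moreover have "\<exists>d\<in>J. b d \<noteq> 0" using c(1) by (auto simp: b_def)
    ultimately show ?thesis using c(2) by (intro exI[of _ b]) auto
  qed
qed

section \<open>The tensor product as a module for N = g - 1\<close>

locale tensor_setting = group G for G :: "('g, 'h) monoid_scheme" (structure) +
  fixes g :: 'g and q r s :: nat and \<rho> :: "'g \<Rightarrow> (nat \<Rightarrow> 'f::field) \<Rightarrow> nat \<Rightarrow> 'f"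
  assumes g: "g \<in> carrier G" and gen: "carrier G = generate G {g}" and fin: "finite (carrier G)"
    and M: "jordan_block_module G g q \<rho>" and rq: "r \<le> q" and sq: "s \<le> q"
begin

lemmas V_inv = V_invariant[OF is_group g gen fin M]

abbreviation N where "N \<equiv> gm1 g r s \<rho>"

abbreviation TT where "TT \<equiv> tensor_space (V r) (V s) :: (nat \<times> nat \<Rightarrow> 'f) set"

lemma FG: "FG_module G fscale (V q) \<rho>"
  using M by (simp add: jordan_block_module_def)

lemma V_mono: "u \<in> V d \<Longrightarrow> d \<le> q \<Longrightarrow> u \<in> V q"
  by (auto simp: V_iff)

lemma linear_N: "Vector_Spaces.linear fscale fscale N"
  unfolding Vector_Spaces.linear_iff
  by (auto simp: vector_space_fscale gm1_def tensor_act_def fscale_def fun_eq_iff sum_fun_apply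
      algebra_simps sum_distrib_left sum.distrib)

lemma tens_sum_left: "tens (\<Sum>i\<in>A. fscale (c i) (h i)) w = (\<Sum>i\<in>A. fscale (c i) (tens (h i) w))"
  by (auto simp: fun_eq_iff tens_def sum_fun_apply fscale_def sum_distrib_right mult.assoc)

lemma tens_sum_right: "tens w (\<Sum>i\<in>A. fscale (c i) (h i)) = (\<Sum>i\<in>A. fscale (c i) (tens w (h i)))"
  by (auto simp: fun_eq_iff tens_def sum_fun_apply fscale_def sum_distrib_left mult.left_commute)

lemma act_inverse:
  assumes "w \<in> V q"
  shows "\<rho> (g [^] (k :: int)) (\<rho> (g [^] (- k)) w) = w"
proof -
  have "g [^] k \<otimes> g [^] (- k) = \<one>" using g by (simp add: int_pow_mult[symmetric])
  moreover have "\<rho> (g [^] k \<otimes> g [^] (- k)) w = \<rho> (g [^] k) (\<rho> (g [^] (- k)) w)" "\<rho> \<one> w = w"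
    using FG assms g unfolding FG_module_def by (blast intro: int_pow_closed)+
  ultimately show ?thesis by simp
qed

lemma vv_in_TT:
  assumes "1 \<le> i" "i \<le> int r" "1 \<le> j" "j \<le> int s"
  shows "vv G g \<rho> n i j \<in> TT"
proof -
  have "bvec (nat i) \<in> V r" "\<rho> (g [^] (int n - i)) (bvec (nat j)) \<in> V s"
    using assms sq g by (auto intro!: bvec_in_V V_inv)
  then show ?thesis
    using assms unfolding vv_def tensor_space_def by (auto intro!: fvs.span_base)
qed

lemma TT_subspace: "fvs.subspace TT"
  unfolding tensor_space_def by (rule fvs.subspace_span)

text \<open>The twist by \<open>g [^] (n - i)\<close> depends only on the row i and is invertible on
  V s, so in each row the twisted vectors span the same space as the standard ones.\<close>

lemma TT_span_vv:
  "TT \<subseteq> fspan {vv G g \<rho> n i j | i j. 1 \<le> i \<and> i \<le> int r \<and> 1 \<le> j \<and> j \<le> int s}" (is "_ \<subseteq> fspan ?B")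
proof -
  have "tens u w \<in> fspan ?B" if u: "u \<in> V r" and w: "w \<in> V s" for u w :: "nat \<Rightarrow> 'f"
  proof -
    have uexp: "u = (\<Sum>i = 1..r. fscale (u i) (bvec i))"
      using u by (intro V_expand) (auto simp: V_iff)
    have "tens (bvec i) w \<in> fspan ?B" if i: "i \<in> {1..r}" for i
    proof -
      let ?h = "g [^] (int n - int i)"
      define w' where "w' = \<rho> (g [^] (- (int n - int i))) w"
      have w': "w' \<in> V s" using w sq g by (simp add: w'_def V_inv)
      then have exp: "w' = (\<Sum>j = 1..s. fscale (w' j) (bvec j))"
        by (intro V_expand) (auto simp: V_iff)
      have "w = \<rho> ?h w'"
        unfolding w'_def by (rule act_inverse[symmetric]) (use w sq V_mono in auto)
      also have "\<dots> = \<rho> ?h (\<Sum>j = 1..s. fscale (w' j) (bvec j))" using exp by simp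
      also have "\<dots> = (\<Sum>j = 1..s. fscale (w' j) (\<rho> ?h (bvec j)))"
        using FG_module_sum[OF FG _ sq] g by simp
      finally have "tens (bvec i) w = (\<Sum>j = 1..s. fscale (w' j) (tens (bvec i) (\<rho> ?h (bvec j))))"
        by (simp only: tens_sum_right)
      also have "\<dots> = (\<Sum>j = 1..s. fscale (w' j) (vv G g \<rho> n (int i) (int j)))"
        using i by (intro sum.cong refl) (auto simp: vv_def)
      also have "\<dots> \<in> fspan ?B"
        using i by (intro fvs.span_sum fvs.span_scale fvs.span_base) force
      finally show ?thesis .
    qed
    then show ?thesis
      by (subst uexp) (auto simp: tens_sum_left intro!: fvs.span_sum fvs.span_scale)
  qed
  then show ?thesis
    unfolding tensor_space_def by (intro fvs.span_minimal fvs.subspace_span) auto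
qed

lemma N_in_TT:
  assumes "u \<in> TT"
  shows "N u \<in> TT"
proof -
  have T: "tens u w \<in> TT" if "u \<in> V r" "w \<in> V s" for u w
    using that unfolding tensor_space_def by (intro fvs.span_base) auto
  have "N (tens u w) \<in> TT" if "u \<in> V r" "w \<in> V s" for u w
    unfolding gm1_def tensor_act_tens[OF FG g rq sq that]
    using that g rq sq by (intro fvs.subspace_diff[OF TT_subspace] T V_inv)
  then have "TT \<subseteq> N -` TT"
    unfolding tensor_space_def[of "V r" "V s"]
    by (intro fvs.span_minimal module_hom.subspace_vimage[OF Vector_Spaces.linear.axioms(3)[OF linear_N]] fvs.subspace_span)
       (auto simp: tensor_space_def)
  then show ?thesis using assms by auto
qed

lemma pow_N_in_TT: "u \<in> TT \<Longrightarrow> (N ^^ m) u \<in> TT"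
  by (induction m) (auto intro: N_in_TT)

text \<open>Functionals with freely chosen values stand in for linear independence of the v i j:
  both independence arguments in the main proof evaluate one.\<close>

lemma vv_functional:
  obtains f :: "(nat \<times> nat \<Rightarrow> 'f) \<Rightarrow> 'f" where
    "Vector_Spaces.linear fscale (*) f"
    "\<And>i j. 1 \<le> i \<Longrightarrow> i \<le> int r \<Longrightarrow> 1 \<le> j \<Longrightarrow> j \<le> int s \<Longrightarrow> f (vv G g \<rho> n i j) = w (nat i) (nat j)"
proof
  \<comment> \<open>The coordinate of \<open>u\<close> at \<open>v i j\<close>: undo the twist by \<open>g\<^sup>n\<^sup>-\<^sup>i\<close> in row \<open>i\<close> of \<open>u\<close>.\<close>
  define co where "co i j u = (\<Sum>b = 1..s. u (i, b) * \<rho> (g [^] (- (int n - int i))) (bvec b) j)"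
    for i j :: nat and u :: "nat \<times> nat \<Rightarrow> 'f"
  define f where "f u = (\<Sum>i = 1..r. \<Sum>j = 1..s. w i j * co i j u)" for u
  show "Vector_Spaces.linear fscale (*) f"
    unfolding Vector_Spaces.linear_iff
    by (auto simp: vector_space_fscale f_def co_def fscale_def fun_eq_iff
      algebra_simps sum_distrib_left sum.distrib intro!: vector_space.intro)
  show "f (vv G g \<rho> n i j) = w (nat i) (nat j)"
    if ij: "1 \<le> i" "i \<le> int r" "1 \<le> j" "j \<le> int s" for i j
  proof -
    have "co i' j' (vv G g \<rho> n i j) = (if i' = nat i \<and> j' = nat j then 1 else 0)" for i' j'
    proof (cases "i' = nat i")
      case True
      define h where "h = \<rho> (g [^] (int n - i)) (bvec (nat j))"
      have b: "bvec (nat j) \<in> V s" using ij by (intro bvec_in_V) auto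
      then have "h \<in> V s" using sq g unfolding h_def by (intro V_inv) auto
      then have exp: "h = (\<Sum>b = 1..s. fscale (h b) (bvec b))"
        by (intro V_expand) (auto simp: V_iff)
      have "co i' j' (vv G g \<rho> n i j)
          = (\<Sum>b = 1..s. fscale (h b) (\<rho> (g [^] (- (int n - i))) (bvec b))) j'"
        using True ij by (simp add: co_def vv_def h_def tens_def bvec_def[of "nat i"] sum_fun_apply fscale_def)
      also have "\<dots> = \<rho> (g [^] (- (int n - i))) h j'"
        using FG_module_sum[OF FG _ sq, of _ h] g exp by simp
      also have "\<dots> = bvec (nat j) j'"
        using act_inverse[OF V_mono[OF b sq], of "- (int n - i)"] by (simp only: h_def minus_minus)
      finally show ?thesis using True by (simp add: bvec_def)
    next
      case False
      then show ?thesis using ij by (simp add: co_def vv_def tens_def bvec_def[of "nat i"])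
    qed
    then have "f (vv G g \<rho> n i j) = (\<Sum>i' = 1..r. \<Sum>j' = 1..s. if i' = nat i \<and> j' = nat j then w i' j' else 0)"
      unfolding f_def by (intro sum.cong refl) auto
    also have "\<dots> = (\<Sum>i' = 1..r. if i' = nat i then w i' (nat j) else 0)"
      using ij by (intro sum.cong refl) auto
    also have "\<dots> = w (nat i) (nat j)" using ij by auto
    finally show ?thesis .
  qed
qed

text \<open>On a Jordan block g - 1 lowers basis indices by one, hence moves coordinates down by
  one. Position 0 is exceptional since coordinates start at 1 and g - 1 kills
  \<open>bvec 1\<close>.\<close>

lemma act_shift:
  assumes "w \<in> V q"
  shows "\<rho> g w - w = (\<lambda>j. if j = 0 then 0 else w (Suc j))"
proof
  fix j
  have exp: "w = (\<Sum>i = 1..q. fscale (w i) (bvec i))"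
    using assms by (intro V_expand) (auto simp: V_iff)
  have b: "\<rho> g (bvec i) j = bvec i j + (if j \<noteq> 0 \<and> i = Suc j then 1 else 0)" if "i \<in> {1..q}" for i
    using that M by (cases "i = 1") (auto simp: jordan_block_module_def bvec_def)
  have "\<rho> g w j = (\<Sum>i = 1..q. fscale (w i) (\<rho> g (bvec i))) j"
    using FG_module_sum[OF FG g, of q w] exp by simp
  also have "\<dots> = (\<Sum>i = 1..q. w i * bvec i j) + (\<Sum>i = 1..q. if j \<noteq> 0 \<and> i = Suc j then w i else 0)"
    unfolding sum_fun_apply fscale_def sum.distrib[symmetric]
    by (intro sum.cong refl) (auto simp: b algebra_simps)
  also have "(\<Sum>i = 1..q. w i * bvec i j) = w j"
    by (subst (2) exp) (simp add: sum_fun_apply fscale_def)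
  also have "(\<Sum>i = 1..q. if j \<noteq> 0 \<and> i = Suc j then w i else 0) = (if j = 0 then 0 else w (Suc j))"
    using assms by (auto simp: V_iff)
  finally show "(\<rho> g w - w) j = (if j = 0 then 0 else w (Suc j))" by simp
qed

section \<open>Coordinates with respect to the Jordan blocks\<close>

context
  fixes lam :: "nat \<Rightarrow> nat"
  assumes dec: "tensor_decomposition G q \<rho> r s lam"
begin

abbreviation W where
  "W \<equiv> dsum_carrier {1..min r s} (\<lambda>i. V (lam i)) :: (nat \<Rightarrow> nat \<Rightarrow> 'f) set"

lemma W_component: "h \<in> W \<Longrightarrow> h i \<in> V q"
  using dec unfolding tensor_decomposition_def
  by (cases "i \<in> {1..min r s}") (fastforce simp: dsum_carrier_def V_iff)+

lemma W_top: "h \<in> W \<Longrightarrow> lam i < j \<Longrightarrow> h i j = 0"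
  by (cases "i \<in> {1..min r s}") (auto simp: dsum_carrier_def V_iff)

lemma W_bot: "h \<in> W \<Longrightarrow> h i 0 = 0"
  by (cases "i \<in> {1..min r s}") (auto simp: dsum_carrier_def V_iff)

text \<open>By \<open>act_shift\<close>, the isomorphism turns \<open>N ^^ m\<close> into a shift by
  m inside each summand. Linearity is restricted to vectors of \<open>TT\<close>, the only place
  where an isomorphism is constrained.\<close>

lemma coordinates:
  obtains \<phi> :: "(nat \<times> nat \<Rightarrow> 'f) \<Rightarrow> nat \<Rightarrow> nat \<Rightarrow> 'f" where
    "bij_betw \<phi> TT W"
    "\<And>A c u. finite A \<Longrightarrow> (\<And>k. k \<in> A \<Longrightarrow> u k \<in> TT) \<Longrightarrow>
       \<phi> (\<Sum>k\<in>A. fscale (c k) (u k)) = (\<lambda>i j. \<Sum>k\<in>A. c k * \<phi> (u (k :: nat)) i j)"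
    "\<And>u i j m. u \<in> TT \<Longrightarrow> \<phi> ((N ^^ m) u) i j = (if j = 0 then 0 else \<phi> u i (j + m))"
proof -
  obtain \<phi> where bij: "bij_betw \<phi> TT W"
    and add: "\<And>u w. u \<in> TT \<Longrightarrow> w \<in> TT \<Longrightarrow> \<phi> (u + w) = \<phi> u + \<phi> w"
    and sc: "\<And>c u. u \<in> TT \<Longrightarrow> \<phi> (fscale c u) = dsum_scale fscale c (\<phi> u)"
    and act: "\<And>x u. x \<in> carrier G \<Longrightarrow> u \<in> TT \<Longrightarrow> \<phi> (tensor_act r s \<rho> x u) = dsum_act \<rho> x (\<phi> u)"
    using dec unfolding tensor_decomposition_def FG_isomorphic_def by blast
  have W: "\<phi> u \<in> W" if "u \<in> TT" for u using that bij by (auto simp: bij_betw_def)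
  have zero: "\<phi> 0 = 0"
    using add[of 0 0] fvs.subspace_0[OF TT_subspace] by simp
  have 1: "\<phi> (\<Sum>k\<in>A. fscale (c k) (u k)) = (\<lambda>i j. \<Sum>k\<in>A. c k * \<phi> (u (k :: nat)) i j)"
    if "finite A" "\<And>k. k \<in> A \<Longrightarrow> u k \<in> TT" for A c u
    using that
  proof (induction A rule: finite_induct)
    case empty
    have "\<phi> (\<Sum>k\<in>{}. fscale (c k) (u k)) = 0" by (simp only: sum.empty zero)
    then show ?case by (simp only: sum.empty zero_fun_def)
  next
    case (insert x A)
    have sx: "\<phi> (fscale (c x) (u x)) = dsum_scale fscale (c x) (\<phi> (u x))"
      using insert.prems by (intro sc) simp
    have IH: "\<phi> (\<Sum>k\<in>A. fscale (c k) (u k)) = (\<lambda>i j. \<Sum>k\<in>A. c k * \<phi> (u k) i j)"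
      using insert.prems by (intro insert.IH) simp
    have "\<phi> (\<Sum>k\<in>insert x A. fscale (c k) (u k)) = \<phi> (fscale (c x) (u x) + (\<Sum>k\<in>A. fscale (c k) (u k)))"
      using insert.hyps by simp
    also have "\<dots> = \<phi> (fscale (c x) (u x)) + \<phi> (\<Sum>k\<in>A. fscale (c k) (u k))"
      using insert.prems
      by (intro add fvs.subspace_sum[OF TT_subspace] fvs.subspace_scale[OF TT_subspace]) auto
    also have "\<dots> = (\<lambda>i j. \<Sum>k\<in>insert x A. c k * \<phi> (u k) i j)"
      unfolding sx IH using insert.hyps by (simp add: dsum_scale_def fscale_def fun_eq_iff)
    finally show ?case .
  qed
  have N: "\<phi> (N u) i j = (if j = 0 then 0 else \<phi> u i (Suc j))" if u: "u \<in> TT" for u i j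
  proof -
    have "tensor_act r s \<rho> g u = N u + u" by (simp add: gm1_def)
    then have "\<phi> (N u) + \<phi> u = dsum_act \<rho> g (\<phi> u)"
      using act[OF g u] add[OF N_in_TT[OF u] u] by simp
    then have "\<phi> (N u) i + \<phi> u i = \<rho> g (\<phi> u i)"
      unfolding dsum_act_def by (metis plus_fun_apply)
    then have "\<phi> (N u) i = \<rho> g (\<phi> u i) - \<phi> u i" by (simp only: eq_diff_eq)
    then show ?thesis using act_shift[OF W_component[OF W[OF u]], of i] by (simp add: fun_eq_iff)
  qed
  have 2: "\<phi> ((N ^^ m) u) i j = (if j = 0 then 0 else \<phi> u i (j + m))" if u: "u \<in> TT" for u i j m
  proof (induction m arbitrary: j)
    case 0
    show ?case using W_bot[OF W[OF u]] by simp
  next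
    case (Suc m)
    then show ?case using N[OF pow_N_in_TT[OF u]] by simp
  qed
  show ?thesis by (rule that[OF bij 1 2])
qed

text \<open>On the kernel of \<open>N\<close>, the coefficients at the socles of the summands are injective, and on
  \<open>N\<^sup>m\<close>-images they vanish for the summands with \<open>lam i \<le> m\<close>.\<close>

lemma lam_gt:
  assumes y: "\<And>d. d \<in> {1..D} \<Longrightarrow> y d \<in> TT"
    and ker: "\<And>d. d \<in> {1..D} \<Longrightarrow> (N ^^ Suc m) (y d) = 0"
    and indep: "\<And>c d. (\<Sum>d = 1..D. fscale (c d) ((N ^^ m) (y d))) = 0 \<Longrightarrow> d \<in> {1..D} \<Longrightarrow> c d = 0"
    and l: "l \<in> {1..min r s}" "l \<le> D"
  shows "m < lam l"
proof (rule ccontr)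
  assume "\<not> m < lam l"
  \<comment> \<open>The summands longer than m. As lam decreases, a failure at l puts them all
    before l, so D >= l vectors face fewer than D socle coefficients and some nontrivial combination
    has all of these 0.\<close>
  define I where "I = {i \<in> {1..min r s}. m < lam i}"
  have "I \<subseteq> {1..<l}"
  proof
    fix i assume "i \<in> I"
    moreover have "lam i \<le> lam l" if "l \<le> i" "i \<le> min r s"
      using dec that l unfolding tensor_decomposition_def by auto
    ultimately show "i \<in> {1..<l}" using \<open>\<not> m < lam l\<close> by (force simp: I_def)
  qed
  then have "card I \<le> l - 1" using card_mono[of "{1..<l}" I] by simp
  then have "card I < card {1..D}" using l unfolding card_atLeastAtMost atLeastAtMost_iff by linarith
  obtain \<phi> where \<phi>: "bij_betw \<phi> TT W"
    "\<And>A c u. finite A \<Longrightarrow> (\<And>k. k \<in> A \<Longrightarrow> u k \<in> TT) \<Longrightarrow>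
       \<phi> (\<Sum>k\<in>A. fscale (c k) (u k)) = (\<lambda>i j. \<Sum>k\<in>A. c k * \<phi> (u (k :: nat)) i j)"
    "\<And>u i j m. u \<in> TT \<Longrightarrow> \<phi> ((N ^^ m) u) i j = (if j = 0 then 0 else \<phi> u i (j + m))"
    using coordinates by blast
  obtain c where c: "\<exists>d\<in>{1..D}. c d \<noteq> 0"
    "\<And>i. i \<in> I \<Longrightarrow> (\<Sum>d = 1..D. c d * \<phi> ((N ^^ m) (y d)) i 1) = 0"
    using finite_homogeneous_system[OF _ _ \<open>card I < card {1..D}\<close>,
        of "\<lambda>d i. \<phi> ((N ^^ m) (y d)) i 1"] by (auto simp: I_def)
  define x where "x = (\<Sum>d = 1..D. fscale (c d) ((N ^^ m) (y d)))"
  have TTy: "(N ^^ m) (y d) \<in> TT" if "d \<in> {1..D}" for d using y[OF that] by (rule pow_N_in_TT)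
  have x: "x \<in> TT"
    unfolding x_def using TTy by (intro fvs.subspace_sum[OF TT_subspace] fvs.subspace_scale[OF TT_subspace])
  have z: "0 \<in> TT" by (rule fvs.subspace_0[OF TT_subspace])
  have \<phi>0: "\<phi> 0 i j = 0" for i j using \<phi>(2)[of "{}"] by (simp add: fun_eq_iff)
  have W: "\<phi> u \<in> W" if "u \<in> TT" for u using that \<phi>(1) by (auto simp: bij_betw_def)
  \<comment> \<open>Only socle coefficients of summands longer than m can survive
    \<open>N ^^ m\<close>: \<open>ker\<close> removes the positions j >= 2, and at j = 1 the shorter
    summands give 0.\<close>
  have y0: "\<phi> ((N ^^ m) (y d)) i j = 0" if d: "d \<in> {1..D}" and ij: "j \<noteq> 1 \<or> i \<notin> I" for d i j
  proof (cases "j \<le> 1")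
    case False
    then obtain j' where j': "j = Suc j'" "j' \<noteq> 0" by (cases j) auto
    have "\<phi> ((N ^^ Suc m) (y d)) i j' = 0" using ker[OF d] \<phi>0 by simp
    then show ?thesis using j' by (simp add: \<phi>(3)[OF y[OF d]] del: funpow.simps)
  next
    case True
    then consider "j = 0" | "j = 1" "i \<in> {1..min r s}" "lam i \<le> m" | "i \<notin> {1..min r s}"
      using ij by (cases "j = 0") (auto simp: I_def not_less)
    then show ?thesis
    proof cases
      case 1
      then show ?thesis using \<phi>(3)[OF y[OF d]] by simp
    next
      case 2
      then show ?thesis using \<phi>(3)[OF y[OF d]] W_top[OF W[OF y[OF d]], of i "j + m"] by simp
    next
      case 3
      then show ?thesis using W[OF TTy[OF d]] by (auto simp: dsum_carrier_def)
    qed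
  qed
  have \<phi>x: "\<phi> x i j = (\<Sum>d = 1..D. c d * \<phi> ((N ^^ m) (y d)) i j)" for i j
    unfolding x_def using \<phi>(2)[of "{1..D}" "\<lambda>d. (N ^^ m) (y d)" c] TTy by simp
  have "\<phi> x i j = 0" for i j
  proof (cases "j = 1 \<and> i \<in> I")
    case True
    then show ?thesis unfolding \<phi>x using c(2)[of i] by simp
  next
    case False
    then show ?thesis unfolding \<phi>x by (intro sum.neutral ballI) (simp add: y0)
  qed
  then have "\<phi> x = \<phi> 0" using \<phi>0 by (simp add: fun_eq_iff)
  then have "x = 0" using \<phi>(1) x z by (auto simp: bij_betw_def inj_on_def)
  then have "c d = 0" if "d \<in> {1..D}" for d using that unfolding x_def by (rule indep)
  then show False using c(1) by blast
qed

text \<open>Modulo the image of \<open>N\<close>, a vector is determined by its coefficients at the tops of the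
  summands, and on the kernel of \<open>N\<^sup>m\<close> those with \<open>m < lam i\<close> vanish.\<close>

lemma lam_le:
  assumes y: "\<And>d. d \<in> {1..D} \<Longrightarrow> y d \<in> TT"
    and ker: "\<And>d. d \<in> {1..D} \<Longrightarrow> (N ^^ m) (y d) = 0"
    and indep: "\<And>c u d. u \<in> TT \<Longrightarrow> (\<Sum>d = 1..D. fscale (c d) (y d)) = N u \<Longrightarrow> d \<in> {1..D} \<Longrightarrow> c d = 0"
    and l: "l \<in> {1..min r s}" "min r s < l + D"
  shows "lam l \<le> m"
proof (rule ccontr)
  assume "\<not> lam l \<le> m"
  \<comment> \<open>Here a failure at l puts the summands of length at most m after l, so there are
    at most min r s - l < D of them.\<close>
  define I where "I = {i \<in> {1..min r s}. lam i \<le> m}"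
  have "I \<subseteq> {l<..min r s}"
  proof
    fix i assume "i \<in> I"
    moreover have "lam l \<le> lam i" if "1 \<le> i" "i \<le> l"
      using dec that l unfolding tensor_decomposition_def by auto
    ultimately show "i \<in> {l<..min r s}" using \<open>\<not> lam l \<le> m\<close> by (force simp: I_def)
  qed
  then have "card I \<le> min r s - l" using card_mono[of "{l<..min r s}" I] by simp
  then have "card I < card {1..D}" using l unfolding card_atLeastAtMost atLeastAtMost_iff by linarith
  obtain \<phi> where \<phi>: "bij_betw \<phi> TT W"
    "\<And>A c u. finite A \<Longrightarrow> (\<And>k. k \<in> A \<Longrightarrow> u k \<in> TT) \<Longrightarrow>
       \<phi> (\<Sum>k\<in>A. fscale (c k) (u k)) = (\<lambda>i j. \<Sum>k\<in>A. c k * \<phi> (u (k :: nat)) i j)"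
    "\<And>u i j m. u \<in> TT \<Longrightarrow> \<phi> ((N ^^ m) u) i j = (if j = 0 then 0 else \<phi> u i (j + m))"
    using coordinates by blast
  obtain c where c: "\<exists>d\<in>{1..D}. c d \<noteq> 0"
    "\<And>i. i \<in> I \<Longrightarrow> (\<Sum>d = 1..D. c d * \<phi> (y d) i (lam i)) = 0"
    using finite_homogeneous_system[OF _ _ \<open>card I < card {1..D}\<close>,
        of "\<lambda>d i. \<phi> (y d) i (lam i)"] by (auto simp: I_def)
  define x where "x = (\<Sum>d = 1..D. fscale (c d) (y d))"
  have x: "x \<in> TT"
    unfolding x_def using y by (intro fvs.subspace_sum[OF TT_subspace] fvs.subspace_scale[OF TT_subspace])
  have \<phi>0: "\<phi> 0 i j = 0" for i j using \<phi>(2)[of "{}"] by (simp add: fun_eq_iff)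
  have W: "\<phi> u \<in> W" if "u \<in> TT" for u using that \<phi>(1) by (auto simp: bij_betw_def)
  have \<phi>x: "\<phi> x i j = (\<Sum>d = 1..D. c d * \<phi> (y d) i j)" for i j
    unfolding x_def using \<phi>(2)[of "{1..D}" y c] y by simp
  have top: "\<phi> x i (lam i) = 0" if i: "i \<in> {1..min r s}" for i
  proof (cases "i \<in> I")
    case True
    then show ?thesis using c(2) by (simp add: \<phi>x)
  next
    case False
    then have "m < lam i" using i by (simp add: I_def)
    have "\<phi> (y d) i (lam i) = 0" if d: "d \<in> {1..D}" for d
      using \<phi>(3)[OF y[OF d], of m i "lam i - m"] ker[OF d] \<phi>0[of i "lam i - m"] \<open>m < lam i\<close> by simp
    then show ?thesis by (simp add: \<phi>x)
  qed
  \<comment> \<open>A preimage of x under the shift: coordinates move up by one, which stays inside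
    the summands because the top coefficients are 0.\<close>
  define h where "h i j = (if 2 \<le> j then \<phi> x i (j - 1) else 0)" for i j
  have "h \<in> W"
    unfolding dsum_carrier_def
  proof (intro CollectI conjI ballI allI impI)
    fix i assume i: "i \<in> {1..min r s}"
    have "h i j = 0" if "j \<notin> {1..lam i}" for j
    proof (cases "j = Suc (lam i)")
      case True
      then show ?thesis using top[OF i] by (simp add: h_def)
    next
      case False
      then show ?thesis using that W_top[OF W[OF x], of i "j - 1"] by (auto simp: h_def)
    qed
    then show "h i \<in> V (lam i)" by (simp add: V_iff)
  next
    fix i assume "i \<notin> {1..min r s}"
    then show "h i = 0" using W[OF x] by (auto simp: h_def dsum_carrier_def fun_eq_iff)
  qed
  then have "h \<in> \<phi> ` TT" using \<phi>(1) by (simp only: bij_betw_def)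
  then obtain u where u: "u \<in> TT" "\<phi> u = h" by (elim imageE) simp
  have "\<phi> (N u) i j = \<phi> x i j" for i j
    using \<phi>(3)[OF u(1), of 1 i j] W_bot[OF W[OF x], of i] by (auto simp: u(2) h_def)
  then have "\<phi> (N u) = \<phi> x" by (simp add: fun_eq_iff)
  then have "x = N u" using \<phi>(1) x N_in_TT[OF u(1)] by (auto simp: bij_betw_def inj_on_def)
  then have "c d = 0" if "d \<in> {1..D}" for d using that unfolding x_def by (rule indep[OF u(1)])
  then show False using c(1) by blast
qed

end

end

section \<open>Both formulas and the block size\<close>

theorem proposition2:
  fixes G :: "('g, 'h) monoid_scheme"
    and g :: 'g
    and p a q r s n rn R sn S t k l :: nat
    and \<rho> :: "'g \<Rightarrow> (nat \<Rightarrow> 'f::field) \<Rightarrow> nat \<Rightarrow> 'f"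
    and lam :: "nat \<Rightarrow> nat"
    and \<zeta> :: "'f mat"
    and z y :: "nat \<times> nat \<Rightarrow> 'f"
  assumes "prime p" and "CHAR('f) = p"
    and "0 < a" and "q = p ^ a"
    and "group G" and "g \<in> carrier G" and "carrier G = generate G {g}" and "order G = q"
    and "jordan_block_module G g q \<rho>"
    and "1 \<le> r" and "r \<le> q" and "1 \<le> s" and "s \<le> q"
    and "tensor_decomposition G q \<rho> r s lam"
    and "p ^ n \<le> max r s" and "max r s < p ^ (n + 1)"
    and "r = rn * p ^ n + R" and "rn < p" and "R < p ^ n"
    and "s = sn * p ^ n + S" and "sn < p" and "S < p ^ n"
    and "0 < min R S"
    and "l = t * p ^ n + k" and "1 \<le> k" and "k \<le> p ^ n"
    and "max (int r + int s - int p ^ (n + 1)) 0 + 1 \<le> int l" and "l \<le> min r s"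
    and "t \<le> min rn sn"
    and "int k \<le> max (int R + int S - int p ^ n) 0"
    and z_def: "z = (\<Sum>i = 0..t. fscale ((- 1) ^ i * (- 1) ^ (R - k))
           (vv G g \<rho> n (int i * int p ^ n + int R + 1 - int k)
                       ((int t - int i) * int p ^ n + int S)))"
    and \<zeta>_def: "\<zeta> = the (mat_inverse (Pmat rn sn t)) * Xmat t"
    and y_def: "y = (\<Sum>i = 0..t. fscale (\<zeta> $$ (i, 0) * (- 1) ^ (R - k))
           (vv G g \<rho> n ((int rn - int t + int i) * int p ^ n + int R + 1 - int k)
                       ((int sn - int i) * int p ^ n + int S)))"
  shows "lam l = (rn + sn - 2 * t) * p ^ n + p ^ n \<and>
    (gm1 g r s \<rho> ^^ ((rn + sn - 2 * t) * p ^ n)) `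
        DD G g \<rho> n r s ((int rn + int sn - int t) * int p ^ n + int R + int S - int k)
      \<subseteq> DD G g \<rho> n r s (int t * int p ^ n + int R + int S - int k) \<and>
    (z \<in> DD G g \<rho> n r s (int t * int p ^ n + int R + int S - int k) \<and>
     (gm1 g r s \<rho> ^^ (p ^ n - 1)) z
       = xx G g \<rho> n ((int t - 1) * int p ^ n + int R + int S + 1 - int k)) \<and>
    (invertible_mat (Pmat rn sn t :: 'f mat) \<and>
     y \<in> DD G g \<rho> n r s ((int rn + int sn - int t) * int p ^ n + int R + int S - int k) \<and>
     (gm1 g r s \<rho> ^^ ((rn + sn - 2 * t) * p ^ n)) y = z)"
proof -
  have "0 < order G"
    using \<open>order G = q\<close> \<open>q = p ^ a\<close> prime_gt_0_nat[OF \<open>prime p\<close>] by simp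
  then have fin: "finite (carrier G)" by (simp add: Coset.order_def card_gt_0_iff)
  interpret group G by fact
  interpret T: tensor_setting G g q r s \<rho>
    by unfold_locales (use assms(6,7,9,11,13) fin in auto)
  interpret lin: Vector_Spaces.linear fscale fscale "gm1 g r s \<rho>" by (rule T.linear_N)
  define v where "v = vv G g \<rho> n"
  have van: "v i j = 0" if "i \<le> 0 \<or> j \<le> 0" for i j using that by (simp add: v_def vv_def)
  interpret B: pascal_blocks "gm1 g r s \<rho>" v r s p n rn sn R S t
  proof
    show "gm1 g r s \<rho> (v i j) = v (i - 1) j + v i (j - 1)" if "i \<le> int r" "j \<le> int s" for i j
    proof (cases "i \<le> 0 \<or> j \<le> 0")
      case True
      then show ?thesis by (auto simp: van lin.zero)
    next
      case False
      then show ?thesis unfolding v_def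
        by (intro gm1_vv[OF \<open>group G\<close> T.g T.gen fin T.M T.rq T.sq]) (use that in auto)
    qed
  qed (use assms(1,2,17,19,20,22,29) van T.linear_N in auto)
  define P where "P = p ^ n"
  have P: "0 < P" using prime_gt_0_nat[OF \<open>prime p\<close>] by (simp add: P_def)
  define C where "C = rn + sn - 2 * t"
  \<comment> \<open>As k is positive, the maximum must be e, so k <= R + S - P. With S < P this
    gives k <= R, and \<open>R - k\<close> is not truncated.\<close>
  have k: "1 \<le> k" "k + P \<le> R + S" "k \<le> R"
    using assms(19,22,25,30) unfolding P_def of_nat_power[symmetric] by linarith+
  have t: "t \<le> rn" "t \<le> sn" using B.t by auto
  \<comment> \<open>The lower bound on l together with k <= e leaves a multiple of P that is
    negative, so its integer factor is negative too.\<close>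
  have small: "rn + sn + 2 \<le> p + t"
  proof -
    have "int r + int s - int p * int P + 1 \<le> int l" using assms(27) by (simp add: P_def)
    moreover have "int r = int rn * int P + int R" "int s = int sn * int P + int S"
      "int l = int t * int P + int k" by (simp_all add: assms(17,20,24) P_def)
    ultimately have "(int rn + int sn + 1 - int p - int t) * int P + 1 \<le> 0"
      using k(2) unfolding left_diff_distrib distrib_right by linarith
    then have "\<not> 0 \<le> int rn + int sn + 1 - int p - int t"
      using mult_nonneg_nonneg[of "int rn + int sn + 1 - int p - int t" "int P"] by linarith
    then show ?thesis by linarith
  qed
  define u where "u j = \<zeta> $$ (j, 0)" for j
  note Pm = Pmat_invertible[OF assms(2) t small] Pmat_inverse_solves[OF assms(2) t small]
    Pmat_inverse_carrier[OF assms(2) t small]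
  have cu: "coeff ([:1, 1:] ^ (rn + sn - 2 * t) * (\<Sum>j\<le>t. monom (u j) j)) (sn - t + i) = (- 1) ^ i"
    if "i \<le> t" for i
  proof -
    have "coeff ([:1, 1:] ^ (rn + sn - 2 * t) * (\<Sum>j\<le>t. monom (u j) j)) (sn - t + i)
        = (Pmat rn sn t * \<zeta>) $$ (i, 0)"
      unfolding u_def using Pm(3) that
      by (intro Pmat_mult_index[OF assms(2) t small, symmetric]) (auto simp: \<zeta>_def)
    also have "\<dots> = Xmat t $$ (i, 0)" using Pm(2) by (simp add: \<zeta>_def)
    finally show ?thesis using that by (simp add: Xmat_def)
  qed
  have row: "(\<Sum>j\<le>t. binom (rn + sn - 2 * t) (int rn - int t + int j - int i) * u j) = (- 1) ^ i"
    if "i \<le> t" for i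
    using Pmat_row[OF assms(2) t small that, of u] cu[OF that] by simp
  have alt: "(\<Sum>j\<le>t. (- 1) ^ j * u j) \<noteq> 0"
    using cu by (rule alternating_sum_nonzero[OF assms(2) t small])
  have pow_y: "(gm1 g r s \<rho> ^^ (C * P)) (B.yvec u (int i)) = B.zvec (int i)" if "1 \<le> i" for i
    unfolding C_def P_def by (rule B.pow_yvec) (use that row in auto)
  have z: "z = fscale ((- 1) ^ (R - k)) (B.zvec (int k))"
    unfolding z_def B.zvec_def fvs.scale_sum_right unfolding v_def
    by (intro sum.cong) (auto simp: mult.commute)
  have y: "y = fscale ((- 1) ^ (R - k)) (B.yvec u (int k))"
    unfolding y_def B.yvec_def fvs.scale_sum_right unfolding v_def u_def
    by (intro sum.cong) (auto simp: mult.commute)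
  have xx: "xx G g \<rho> n d = B.xsum d" for d unfolding xx_def B.xsum_def unfolding v_def by (rule refl)
  let ?DD = "DD G g \<rho> n r s"
  have DD: "v i j \<in> ?DD d" if "i \<le> int r" "j \<le> int s" "i + j = d + 1" for i j d
  proof (cases "i \<le> 0 \<or> j \<le> 0")
    case True
    then show ?thesis unfolding van[OF True] DD_def by (intro fvs.span_zero)
  next
    case False
    then show ?thesis unfolding v_def DD_def
      by (intro fvs.span_base CollectI exI[of _ i] exI[of _ j]) (use that False in auto)
  qed
  have scale_DD: "fscale c w \<in> ?DD d" if "w \<in> ?DD d" for c w d
    using that unfolding DD_def by (rule fvs.span_scale)
  have sum_DD: "(\<Sum>i\<le>t. w i) \<in> ?DD d" if "\<And>i. i \<le> t \<Longrightarrow> w i \<in> ?DD d" for w d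
    using that unfolding DD_def by (intro fvs.span_sum) auto
  have N_DD: "gm1 g r s \<rho> w \<in> ?DD (d - 1)" if "w \<in> ?DD d" for w d
  proof -
    have "?DD d \<subseteq> gm1 g r s \<rho> -` ?DD (d - 1)"
      unfolding DD_def[of G g \<rho> n r s d]
    proof (intro fvs.span_minimal lin.subspace_vimage subsetI)
      fix w assume "w \<in> {vv G g \<rho> n i j |i j. 1 \<le> i \<and> i \<le> int r \<and> 1 \<le> j \<and> j \<le> int s \<and> i + j = d + 1}"
      then obtain i j where "w = v i j" "i \<le> int r" "j \<le> int s" "i + j = d + 1"
        by (auto simp: v_def)
      then have "gm1 g r s \<rho> w = v (i - 1) j + v i (j - 1)" "v (i - 1) j \<in> ?DD (d - 1)"
        "v i (j - 1) \<in> ?DD (d - 1)"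
        by (auto simp: B.step intro!: DD)
      then show "w \<in> gm1 g r s \<rho> -` ?DD (d - 1)"
        by (simp add: DD_def fvs.span_add)
    qed (simp add: DD_def fvs.subspace_span)
    then show ?thesis using that by auto
  qed
  have pow_DD: "(gm1 g r s \<rho> ^^ m) w \<in> ?DD (d - int m)" if "w \<in> ?DD d" for w d m
  proof (induction m)
    case (Suc m)
    then show ?case using N_DD by (fastforce simp: algebra_simps)
  qed (use that in simp)

  have "y \<in> ?DD ((int rn + int sn - int t) * int p ^ n + int R + int S - int k)"
    unfolding y B.yvec_def
    by (intro scale_DD sum_DD DD B.index_le) (use k t in \<open>auto simp: algebra_simps\<close>)
  moreover have "z \<in> ?DD (int t * int p ^ n + int R + int S - int k)"
    unfolding z B.zvec_def
    by (intro scale_DD sum_DD DD B.index_le) (use k t in \<open>auto simp: algebra_simps\<close>)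
  moreover have "(gm1 g r s \<rho> ^^ ((rn + sn - 2 * t) * p ^ n)) `
        ?DD ((int rn + int sn - int t) * int p ^ n + int R + int S - int k)
      \<subseteq> ?DD (int t * int p ^ n + int R + int S - int k)"
  proof -
    have "int (rn + sn - 2 * t) = int rn + int sn - 2 * int t" using t by simp
    then have "(int rn + int sn - int t) * int p ^ n + int R + int S - int k
        - int ((rn + sn - 2 * t) * p ^ n) = int t * int p ^ n + int R + int S - int k"
      unfolding of_nat_mult by (simp add: algebra_simps)
    then show ?thesis
      using pow_DD[where d = "(int rn + int sn - int t) * int p ^ n + int R + int S - int k"]
      by (metis image_subsetI)
  qed
  moreover have "(gm1 g r s \<rho> ^^ (p ^ n - 1)) z
      = xx G g \<rho> n ((int t - 1) * int p ^ n + int R + int S + 1 - int k)"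
  proof -
    \<comment> \<open>The sign built into z cancels the one produced by
      \<open>pow_zvec\<close>.\<close>
    have "R - k + (R + k) = 2 * R" using k by simp
    then have "(- 1 :: 'f) ^ (R - k) * (- 1) ^ (R + k) = 1" by (simp add: power_mult flip: power_add)
    then show ?thesis
      unfolding z xx B.pow_scale B.pow_zvec[OF k(1)] fvs.scale_scale by simp
  qed
  moreover have "(gm1 g r s \<rho> ^^ ((rn + sn - 2 * t) * p ^ n)) y = z"
    using pow_y[OF k(1)] by (simp only: y z B.pow_scale C_def P_def)
  moreover have "lam l = (rn + sn - 2 * t) * p ^ n + p ^ n"
  proof (rule antisym)
    have l: "l = t * P + k" "l \<in> {1..min r s}" using assms(24,28) k by (auto simp: P_def)
    have v_TT: "v i j \<in> T.TT" if "i \<le> int r" "j \<le> int s" for i j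
    proof (cases "i \<le> 0 \<or> j \<le> 0")
      case True
      then show ?thesis using fvs.subspace_0[OF T.TT_subspace] by (simp add: van)
    next
      case False
      then show ?thesis using that unfolding v_def by (intro T.vv_in_TT) auto
    qed
    have y_TT: "B.yvec u (int d) \<in> T.TT" if "1 \<le> d" for d
      unfolding B.yvec_def
      by (intro fvs.subspace_sum[OF T.TT_subspace] fvs.subspace_scale[OF T.TT_subspace] v_TT B.index_le)
         (use that t in auto)
    \<comment> \<open>This is t * p^n + e, the number of vectors x_d that are reached from the
      y's.\<close>
    define E where "E = t * P + R + S - P"
    have E: "int E = int t * int P + int R + int S - int P" using k by (simp add: E_def of_nat_diff)
    have RS: "R < P" "S < P" using B.R B.S by (simp_all add: P_def)
    have "t * P \<le> rn * P" "t * P \<le> sn * P" using t by simp_all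
    then have Ers: "E \<le> r" "E \<le> s"
      using RS unfolding E_def B.r B.s P_def[symmetric] by linarith+
    have pow_x: "(gm1 g r s \<rho> ^^ (C * P + (P - 1))) (B.yvec u (int d))
        = fscale ((- 1) ^ (R + d)) (B.xsum (int E + 1 - int d))" if "1 \<le> d" for d
    proof -
      have "(gm1 g r s \<rho> ^^ (C * P + (P - 1))) (B.yvec u (int d))
          = (gm1 g r s \<rho> ^^ (P - 1)) ((gm1 g r s \<rho> ^^ (C * P)) (B.yvec u (int d)))"
        by (simp only: add.commute[of "C * P"] funpow_add o_apply)
      also have "\<dots> = fscale ((- 1) ^ (R + d)) (B.xsum (int E + 1 - int d))"
      proof -
        have "int E + 1 - int d = (int t - 1) * int (p ^ n) + int R + int S + 1 - int d"
          by (simp add: E P_def algebra_simps)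
        then show ?thesis
          using B.pow_zvec[OF that] unfolding pow_y[OF that] by (simp only: P_def)
      qed
      finally show ?thesis .
    qed
    have Suc_CP: "Suc (C * P + (P - 1)) = C * P + P" using P by simp
    \<comment> \<open>For d > E the index E + 1 - d is nonpositive and \<open>xsum\<close> is 0, so
      the kernel statement holds for every d >= 1.\<close>
    have ker: "(gm1 g r s \<rho> ^^ (C * P + P)) (B.yvec u (int d)) = 0" if "1 \<le> d" for d
    proof -
      have "B.xsum (int E + 1 - int d) \<in> {w. gm1 g r s \<rho> w = 0}"
        using that Ers by (intro CollectI B.N_xsum) auto
      then show ?thesis
        unfolding Suc_CP[symmetric] using pow_x[OF that] by (simp add: lin.scale)
    qed
    \<comment> \<open>The y's are taken in reverse order and with signs so that the d-th one maps
      exactly to x_d. The requirement l <= E is k <= e.\<close>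
    have "C * P + (P - 1) < lam l"
    proof (rule T.lam_gt[OF assms(14), where D = E])
      fix d assume d: "d \<in> {1..E}"
      define i where "i = E + 1 - d"
      have i: "1 \<le> i" "int E + 1 - int i = int d" using d by (auto simp: i_def of_nat_diff)
      show "fscale ((- 1) ^ (R + (E + 1 - d))) (B.yvec u (int (E + 1 - d))) \<in> T.TT"
        using y_TT[OF i(1)] unfolding i_def by (rule fvs.subspace_scale[OF T.TT_subspace])
      show "(gm1 g r s \<rho> ^^ Suc (C * P + (P - 1)))
          (fscale ((- 1) ^ (R + (E + 1 - d))) (B.yvec u (int (E + 1 - d)))) = 0"
        using ker[OF i(1)] unfolding Suc_CP B.pow_scale i_def by simp
    next
      have x: "(gm1 g r s \<rho> ^^ (C * P + (P - 1)))
          (fscale ((- 1) ^ (R + (E + 1 - d))) (B.yvec u (int (E + 1 - d)))) = B.xsum (int d)"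
        if d: "d \<in> {1..E}" for d
      proof -
        define i where "i = E + 1 - d"
        have i: "1 \<le> i" "int E + 1 - int i = int d" using d by (auto simp: i_def of_nat_diff)
        show ?thesis
          unfolding i_def[symmetric] B.pow_scale pow_x[OF i(1)] fvs.scale_scale i(2)
          by (simp flip: power_mult_distrib)
      qed
      fix c d
      assume "(\<Sum>d = 1..E. fscale (c d) ((gm1 g r s \<rho> ^^ (C * P + (P - 1)))
          (fscale ((- 1) ^ (R + (E + 1 - d))) (B.yvec u (int (E + 1 - d)))))) = 0"
        and d: "d \<in> {1..E}"
      then have s0: "(\<Sum>d = 1..E. fscale (c d) (B.xsum (int d))) = 0" using x by simp
      obtain f where f: "Vector_Spaces.linear fscale (*) f"
        and fv: "\<And>i j. 1 \<le> i \<Longrightarrow> i \<le> int r \<Longrightarrow> 1 \<le> j \<Longrightarrow> j \<le> int s \<Longrightarrow>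
          f (vv G g \<rho> n i j) = (if nat i = 1 \<and> nat j = d then 1 else 0)"
        using T.vv_functional[of n "\<lambda>i j. if i = 1 \<and> j = d then 1 else 0"] by blast
      interpret f: Vector_Spaces.linear fscale "(*)" f by (rule f)
      have "f (B.xsum (int e)) = (if int e = int d then 1 else 0)" if "e \<in> {1..E}" for e
        by (rule B.functional_xsum[OF f]) (use that Ers in \<open>auto simp: v_def fv\<close>)
      then have "f (\<Sum>d = 1..E. fscale (c d) (B.xsum (int d))) = (\<Sum>e = 1..E. if e = d then c e else 0)"
        unfolding f.sum f.scale by (intro sum.cong refl) auto
      then show "c d = 0" using d unfolding s0 f.zero by simp
    qed (use l k in \<open>auto simp: E_def\<close>)
    then show "(rn + sn - 2 * t) * p ^ n + p ^ n \<le> lam l" using P by (simp add: C_def P_def)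
    \<comment> \<open>With D = min r s - t * P the sum l + D is min r s + k, so k >= 1 is just what
      \<open>lam_le\<close> asks for.\<close>
    have "lam l \<le> C * P + P"
    proof (rule T.lam_le[OF assms(14), where D = "min r s - t * P" and y = "\<lambda>d. B.yvec u (int d)"])
      fix c w d
      assume w: "w \<in> T.TT" and eq: "(\<Sum>d = 1..min r s - t * P. fscale (c d) (B.yvec u (int d))) = gm1 g r s \<rho> w"
        and d: "d \<in> {1..min r s - t * P}"
      \<comment> \<open>The antidiagonal that carries all summands of \<open>yvec u d\<close>. The
        bounds \<open>td\<close> amount to r < K and s < K.\<close>
      define K where "K = int r + int s + 1 - int t * int (p ^ n) - int d"
      have td: "int t * int P + int d \<le> int r" "int t * int P + int d \<le> int s"
        using d by (auto simp flip: of_nat_mult of_nat_add)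
      obtain f where f: "Vector_Spaces.linear fscale (*) f"
        and fv: "\<And>i j. 1 \<le> i \<Longrightarrow> i \<le> int r \<Longrightarrow> 1 \<le> j \<Longrightarrow> j \<le> int s \<Longrightarrow>
          f (vv G g \<rho> n i j) = (if int (nat i) + int (nat j) = K then (- 1) ^ nat i else 0)"
        using T.vv_functional[of n "\<lambda>i j. if int i + int j = K then (- 1) ^ i else 0"] by blast
      interpret f: Vector_Spaces.linear fscale "(*)" f by (rule f)
      have fv': "f (v i j) = (if i + j = K then (- 1) ^ nat i else 0)"
        if "1 \<le> i" "i \<le> int r" "1 \<le> j" "j \<le> int s" for i j
        using fv[OF that] that by (simp add: v_def)
      have "f (gm1 g r s \<rho> w) = 0"
      proof -
        interpret fN: Vector_Spaces.linear fscale "(*)" "f \<circ> gm1 g r s \<rho>"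
          by (rule Vector_Spaces.linear_compose[OF T.linear_N f])
        have "(f \<circ> gm1 g r s \<rho>) w = 0"
        proof (rule fN.eq_0_on_span)
          show "w \<in> fspan {vv G g \<rho> n i j |i j. 1 \<le> i \<and> i \<le> int r \<and> 1 \<le> j \<and> j \<le> int s}"
            using w T.TT_span_vv by blast
          fix x assume "x \<in> {vv G g \<rho> n i j |i j. 1 \<le> i \<and> i \<le> int r \<and> 1 \<le> j \<and> j \<le> int s}"
          then obtain i j where x: "x = v i j" and ij: "1 \<le> i" "i \<le> int r" "1 \<le> j" "j \<le> int s"
            by (auto simp: v_def)
          have "f (gm1 g r s \<rho> (v i j)) = 0"
            by (rule B.functional_N[OF f fv' _ _ ij]) (use td in \<open>auto simp: K_def P_def\<close>)
          then show "(f \<circ> gm1 g r s \<rho>) x = 0" by (simp add: x)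
        qed
        then show ?thesis by simp
      qed
      \<comment> \<open>The value of f on \<open>yvec u d\<close>: a signed alternating sum of
        \<zeta>, nonzero by \<open>alt\<close>.\<close>
      define b where "b = (- 1) ^ nat (int r + 1 - int t * int (p ^ n) - int d) * (\<Sum>i\<le>t. (- 1) ^ i * u i)"
      have "b \<noteq> 0" using alt by (simp add: b_def)
      have fy: "f (B.yvec u (int e)) = (if int e = int d then b else 0)" if "e \<in> {1..min r s - t * P}" for e
        unfolding b_def
        by (rule B.functional_yvec[OF f]) (use that d td assms(23) fv' in \<open>auto simp: K_def P_def\<close>)
      have "f (\<Sum>d = 1..min r s - t * P. fscale (c d) (B.yvec u (int d)))
          = (\<Sum>e = 1..min r s - t * P. if e = d then c e * b else 0)"
        unfolding f.sum f.scale by (intro sum.cong refl) (auto simp: fy)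
      then have "c d * b = 0" using d \<open>f (gm1 g r s \<rho> w) = 0\<close> unfolding eq by simp
      then show "c d = 0" using \<open>b \<noteq> 0\<close> by simp
    qed (use l k y_TT ker in auto)
    then show "lam l \<le> (rn + sn - 2 * t) * p ^ n + p ^ n" by (simp add: C_def P_def)
  qed
  ultimately show ?thesis using Pm(1) by blast
qed

end
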